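(* Let $n,\Delta$ be positive integers with $\Delta\le n$. The number of $n$-dimensional empty $\Delta$-modular simplices, counted modulo integer-equivalence, is bounded by $O\!\left(\frac n\Delta\right)^{\Delta-1}\cdot\Delta^{\log_2(\Delta)+2}$; in particular, for fixed $\Delta$ it is bounded by a polynomial in $n$ of degree $\Delta-1$.
   Context: An $n$-dimensional simplex $\mathcal{S}\subseteq\mathbb{R}^n$ is $\Delta$-modular if $\mathcal{S}=\{x: Ax\le b\}$ for some $A\in\mathbb{Z}^{(n+1)\times n}$ with $\operatorname{rank}(A)=n$ and $b\in\mathbb{Z}^{n+1}$, where $\Delta=\Delta(A)$ is the maximum absolute value of $n\times n$ minors of $A$. A simplex is empty if $\mathcal{S}\cap\mathbb{Z}^n=\emptyset$. Two simplices $\mathcal{S},\mathcal{S}'$ are integer-equivalent if $\mathcal{S}'=T(\mathcal{S})$ for an affine map $T(x)=Qx+q$ with $Q$ an integer unimodular $n\times n$ matrix and $q\in\mathbb{Z}^n$. *)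

theory Defs
  imports
    Complex_Main
    "HOL-Computational_Algebra.Polynomial"
    "Jordan_Normal_Form.Matrix"
    "Jordan_Normal_Form.Determinant"
    "Jordan_Normal_Form.DL_Rank"
    "Jordan_Normal_Form.DL_Submatrix"
begin

text \<open>
  The dimension \<open>n\<close> has to vary inside one statement, because the implied constant of the bound is
  uniform in \<open>n\<close>. Hence \<open>\<real>\<^sup>n\<close> is \<^term>\<open>carrier_vec n :: real vec set\<close>. A lattice point, an integer
  matrix or an integer right-hand side is an object over \<^typ>\<open>int\<close>, embedded entrywise by
  \<^const>\<open>of_int\<close>.
\<close>

abbreviation real_vec :: "int vec \<Rightarrow> real vec" where
  "real_vec \<equiv> map_vec of_int"

abbreviation real_mat :: "int mat \<Rightarrow> real mat" where
  "real_mat \<equiv> map_mat of_int"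

definition polyhedron :: "nat \<Rightarrow> int mat \<Rightarrow> int vec \<Rightarrow> real vec set" where
  "polyhedron n A b = {x \<in> carrier_vec n. real_mat A *\<^sub>v x \<le> real_vec b}"

text \<open>The columns of the matrix \<open>V\<close> are the points; \<open>V *\<^sub>v c\<close> is their combination with
  coefficients \<open>c\<close>.\<close>

definition affinely_independent_cols :: "real mat \<Rightarrow> bool" where
  "affinely_independent_cols V \<longleftrightarrow>
     (\<forall>c \<in> carrier_vec (dim_col V).
        (\<Sum>i<dim_col V. c $ i) = 0 \<and> V *\<^sub>v c = 0\<^sub>v (dim_row V) \<longrightarrow> c = 0\<^sub>v (dim_col V))"

definition convex_hull_cols :: "real mat \<Rightarrow> real vec set" where
  "convex_hull_cols V =
     {V *\<^sub>v c | c. c \<in> carrier_vec (dim_col V) \<and> 0\<^sub>v (dim_col V) \<le> c \<and> (\<Sum>i<dim_col V. c $ i) = 1}"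

definition full_dim_simplex :: "nat \<Rightarrow> real vec set \<Rightarrow> bool" where
  "full_dim_simplex n S \<longleftrightarrow>
     (\<exists>V \<in> carrier_mat n (n + 1). affinely_independent_cols V \<and> S = convex_hull_cols V)"

text \<open>The largest absolute value of a minor of \<open>A\<close> using all columns, for \<open>A\<close> with at least as many
  rows as columns.\<close>

definition max_minor :: "int mat \<Rightarrow> int" where
  "max_minor A =
     Max {\<bar>det (submatrix A I {..<dim_col A})\<bar> | I. I \<subseteq> {..<dim_row A} \<and> card I = dim_col A}"

definition modular_simplex :: "nat \<Rightarrow> nat \<Rightarrow> real vec set \<Rightarrow> bool" where
  "modular_simplex n \<Delta> S \<longleftrightarrow> full_dim_simplex n S \<and>
     (\<exists>A \<in> carrier_mat (n + 1) n. \<exists>b \<in> carrier_vec (n + 1).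
        vec_space.rank (n + 1) (real_mat A) = n \<and> max_minor A = int \<Delta> \<and> S = polyhedron n A b)"

text \<open>Empty means free of all lattice points; the vertices, which need not be integral, are not
  exempt.\<close>

definition lattice_free :: "nat \<Rightarrow> real vec set \<Rightarrow> bool" where
  "lattice_free n S \<longleftrightarrow> S \<inter> real_vec ` carrier_vec n = {}"

definition empty_modular_simplices :: "nat \<Rightarrow> nat \<Rightarrow> real vec set set" where
  "empty_modular_simplices n \<Delta> = {S. modular_simplex n \<Delta> S \<and> lattice_free n S}"

definition integer_equivalence :: "nat \<Rightarrow> (real vec set \<times> real vec set) set" where
  "integer_equivalence n =
     {(S, S'). S \<subseteq> carrier_vec n \<and>
        (\<exists>Q \<in> carrier_mat n n. \<exists>q \<in> carrier_vec n. \<bar>det Q\<bar> = 1 \<and>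
           S' = (\<lambda>x. real_mat Q *\<^sub>v x + real_vec q) ` S)}"

definition empty_modular_classes :: "nat \<Rightarrow> nat \<Rightarrow> real vec set set set" where
  "empty_modular_classes n \<Delta> = empty_modular_simplices n \<Delta> // integer_equivalence n"

lemma integer_equivalence_refl:
  assumes "S \<subseteq> carrier_vec n"
  shows "(S, S) \<in> integer_equivalence n"
proof -
  have "(\<lambda>x. real_mat (1\<^sub>m n) *\<^sub>v x + real_vec (0\<^sub>v n)) ` S = (\<lambda>x. x) ` S"
  proof (rule image_cong[OF refl])
    fix x assume "x \<in> S"
    then have x: "x \<in> carrier_vec n" using assms by blast
    have m: "real_mat (1\<^sub>m n) = 1\<^sub>m n" and v: "real_vec (0\<^sub>v n) = 0\<^sub>v n" by auto
    show "real_mat (1\<^sub>m n) *\<^sub>v x + real_vec (0\<^sub>v n) = x" unfolding m v using x by simp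
  qed
  then have "S = (\<lambda>x. real_mat (1\<^sub>m n) *\<^sub>v x + real_vec (0\<^sub>v n)) ` S" by simp
  moreover have "\<bar>det (1\<^sub>m n :: int mat)\<bar> = 1" by simp
  ultimately show ?thesis
    unfolding integer_equivalence_def using assms
    by (auto intro!: bexI[of _ "1\<^sub>m n"] bexI[of _ "0\<^sub>v n"])
qed

lemma integer_equivalence_trans:
  assumes "(S, T) \<in> integer_equivalence n" "(T, U) \<in> integer_equivalence n"
  shows "(S, U) \<in> integer_equivalence n"
proof -
  from assms(1) obtain P p where S: "S \<subseteq> carrier_vec n"
    and P: "P \<in> carrier_mat n n" "p \<in> carrier_vec n" "\<bar>det P\<bar> = 1"
    and T: "T = (\<lambda>x. real_mat P *\<^sub>v x + real_vec p) ` S"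
    unfolding integer_equivalence_def by auto
  from assms(2) obtain Q q
    where Q: "Q \<in> carrier_mat n n" "q \<in> carrier_vec n" "\<bar>det Q\<bar> = 1"
    and U: "U = (\<lambda>x. real_mat Q *\<^sub>v x + real_vec q) ` T"
    unfolding integer_equivalence_def by auto
  have "U = (\<lambda>x. real_mat (Q * P) *\<^sub>v x + real_vec (Q *\<^sub>v p + q)) ` S"
    unfolding U T image_image
  proof (rule image_cong[OF refl])
    fix x assume "x \<in> S"
    then have x: "x \<in> carrier_vec n" using S by blast
    have m: "real_mat (Q * P) = real_mat Q * real_mat P"
      using P Q by (simp add: of_int_hom.mat_hom_mult)
    have v: "real_vec (Q *\<^sub>v p + q) = real_mat Q *\<^sub>v real_vec p + real_vec q"
      using P Q by (subst of_int_hom.mult_mat_vec_hom[symmetric, of _ n n]) auto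
    show "real_mat Q *\<^sub>v (real_mat P *\<^sub>v x + real_vec p) + real_vec q =
      real_mat (Q * P) *\<^sub>v x + real_vec (Q *\<^sub>v p + q)"
      unfolding m v using P Q x
      by (subst mult_add_distrib_mat_vec[of _ n n]) (auto simp: assoc_mult_mat_vec[of _ n n])
  qed
  moreover have "\<bar>det (Q * P)\<bar> = 1" using P Q by (simp add: det_mult abs_mult)
  ultimately show ?thesis
    unfolding integer_equivalence_def using S P Q
    by (auto intro!: bexI[of _ "Q * P"] bexI[of _ "Q *\<^sub>v p + q"])
qed

lemma integer_equivalence_sym:
  assumes "(S, T) \<in> integer_equivalence n"
  shows "(T, S) \<in> integer_equivalence n"
proof -
  from assms obtain P p where S: "S \<subseteq> carrier_vec n"
    and P: "P \<in> carrier_mat n n" "p \<in> carrier_vec n" "\<bar>det P\<bar> = 1"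
    and T: "T = (\<lambda>x. real_mat P *\<^sub>v x + real_vec p) ` S"
    unfolding integer_equivalence_def by auto
  define R where "R = det P \<cdot>\<^sub>m adj_mat P"
  have d: "det P * det P = 1" using P(3) by (metis abs_mult_self_eq mult_1)
  have R: "R \<in> carrier_mat n n" using adj_mat(1)[OF P(1)] by (simp add: R_def)
  have RP: "R * P = 1\<^sub>m n"
    using P adj_mat[OF P(1)] d by (auto simp: R_def mult_smult_assoc_mat[of _ n n] intro!: eq_matI)
  have "det R * det P = 1" using det_mult[OF R P(1)] RP by simp
  then have detR: "\<bar>det R\<bar> = 1" using P(3) by (metis abs_1 abs_mult mult.right_neutral)
  have "(\<lambda>x. real_mat R *\<^sub>v x + real_vec (- (R *\<^sub>v p))) ` T = (\<lambda>x. x) ` S"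
    unfolding T image_image
  proof (rule image_cong[OF refl])
    fix x assume "x \<in> S"
    then have x: "x \<in> carrier_vec n" using S by blast
    have m: "real_mat R * real_mat P = 1\<^sub>m n"
      using P R RP by (metis of_int_hom.mat_hom_mult of_int_hom.mat_hom_one)
    have v: "real_vec (- (R *\<^sub>v p)) = - (real_mat R *\<^sub>v real_vec p)"
      using P R by (subst of_int_hom.mult_mat_vec_hom[symmetric, of _ n n]) auto
    have "real_mat R *\<^sub>v (real_mat P *\<^sub>v x) = x"
      using P R x m by (subst assoc_mult_mat_vec[symmetric, of _ n n]) auto
    moreover have w: "real_mat R *\<^sub>v real_vec p \<in> carrier_vec n" using P R by auto
    ultimately show "real_mat R *\<^sub>v (real_mat P *\<^sub>v x + real_vec p) + real_vec (- (R *\<^sub>v p)) = x"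
      unfolding v using P R x by (subst mult_add_distrib_mat_vec[of _ n n]) auto
  qed
  then have "S = (\<lambda>x. real_mat R *\<^sub>v x + real_vec (- (R *\<^sub>v p))) ` T" by simp
  moreover have "T \<subseteq> carrier_vec n" unfolding T using S P by auto
  moreover have "- (R *\<^sub>v p) \<in> carrier_vec n" using R P by auto
  ultimately show ?thesis
    unfolding integer_equivalence_def using R detR by blast
qed

lemma equiv_integer_equivalence: "equiv (Pow (carrier_vec n)) (integer_equivalence n)"
proof (rule equivI)
  show "integer_equivalence n \<subseteq> Pow (carrier_vec n) \<times> Pow (carrier_vec n)"
    by (auto simp: integer_equivalence_def)
  show "refl_on (Pow (carrier_vec n)) (integer_equivalence n)"
    by (auto simp: refl_on_def intro: integer_equivalence_refl)
  show "sym (integer_equivalence n)"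
    by (auto intro: symI integer_equivalence_sym)
  show "trans (integer_equivalence n)"
    by (auto intro: transI integer_equivalence_trans)
qed

end

theory Submission
  imports
    Defs
    "HOL-Library.Function_Algebras"
    "HOL-Combinatorics.Permutations"
    "HOL-Real_Asymp.Real_Asymp"
begin

text \<open>
  Choose rows of \<open>A\<close> forming a matrix \<open>B\<close> with \<open>\<bar>det B\<bar> = \<Delta>\<close>. Cramer's rule writes the remaining row
  as \<open>- (\<lambda> B) / \<Delta>\<close> with integers \<open>\<bar>\<lambda>\<^sub>i\<bar> \<le> \<Delta>\<close>, positive because the simplex is bounded. In the slack
  coordinates \<open>y = \<beta> - B x\<close> the lattice points of the simplex are the \<open>y \<ge> 0\<close> in \<open>\<beta> + L\<close> with
  \<open>\<lambda> \<bullet> y \<le> N\<close>, where \<open>L = B \<int>\<^sup>n\<close>, so that an empty simplex has \<open>0 \<le> N < \<Delta>\<^sup>3\<close>.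
  Up to equivalence the simplex is therefore given by the group \<open>G = \<int>\<^sup>n / L\<close> of order \<open>\<Delta>\<close>, the
  multiset of the classes of the \<open>n\<close> unit vectors in \<open>G\<close>, the character of \<open>G\<close> induced by \<open>\<lambda>\<close> (which
  recovers \<open>\<lambda>\<close>, as \<open>1 \<le> \<lambda>\<^sub>i \<le> \<Delta>\<close>), the class of \<open>\<beta>\<close> and \<open>N\<close>. There are \<open>n + \<Delta> - 1\<close> choose
  \<open>\<Delta> - 1\<close> multisets. As \<open>G\<close> has at most \<open>log\<^sub>2 \<Delta>\<close> generators, the number of choices for the other
  data is quasipolynomial in \<open>\<Delta>\<close>, which the factor \<open>C\<^bsup>\<Delta> - 1\<^esup>\<close> absorbs.
\<close>

section \<open>Subgroups of abelian groups: index and small generating sets\<close>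

definition subgrp :: "'a::ab_group_add set \<Rightarrow> bool" where
  "subgrp H \<longleftrightarrow> 0 \<in> H \<and> (\<forall>x\<in>H. \<forall>y\<in>H. x - y \<in> H)"

lemma subgrp_zero: "subgrp H \<Longrightarrow> 0 \<in> H"
  and subgrp_diff: "subgrp H \<Longrightarrow> x \<in> H \<Longrightarrow> y \<in> H \<Longrightarrow> x - y \<in> H"
  by (auto simp: subgrp_def)

lemma subgrp_uminus: "subgrp H \<Longrightarrow> x \<in> H \<Longrightarrow> - x \<in> H"
  using subgrp_diff[of H 0 x] subgrp_zero[of H] by simp

lemma subgrp_add: "subgrp H \<Longrightarrow> x \<in> H \<Longrightarrow> y \<in> H \<Longrightarrow> x + y \<in> H"
  using subgrp_diff[of H x "- y"] subgrp_uminus[of H y] by simp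

lemma subgrp_sum: "subgrp H \<Longrightarrow> (\<And>i. i \<in> I \<Longrightarrow> f i \<in> H) \<Longrightarrow> sum f I \<in> H"
  by (induction I rule: infinite_finite_induct) (auto intro: subgrp_zero subgrp_add)

lemma subgrp_minus_commute: "subgrp H \<Longrightarrow> x - y \<in> H \<longleftrightarrow> y - x \<in> H"
  using subgrp_uminus[of H "x - y"] subgrp_uminus[of H "y - x"] by auto

lemma subgrp_mem_cong:
  assumes "subgrp H" "x - y \<in> H"
  shows "x \<in> H \<longleftrightarrow> y \<in> H"
  using subgrp_diff[OF assms(1) _ assms(2), of x] subgrp_add[OF assms(1) _ assms(2), of y] by auto

lemma subgrp_hull: "subgrp (subgrp hull S)"
  by (rule hull_in) (auto simp: subgrp_def)

lemma subgrp_mult: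
  fixes y :: "nat \<Rightarrow> int"
  assumes "subgrp H" "y \<in> H"
  shows "(\<lambda>i. k * y i) \<in> H"
proof (induction k rule: int_induct[where k = 0])
  case base
  then show ?case using subgrp_zero[OF assms(1)] by (simp add: zero_fun_def)
next
  case (step1 i)
  have "(\<lambda>j. (i + 1) * y j) = (\<lambda>j. i * y j) + y" by (auto simp: algebra_simps)
  then show ?case using step1 subgrp_add assms by metis
next
  case (step2 i)
  have "(\<lambda>j. (i - 1) * y j) = (\<lambda>j. i * y j) - y" by (auto simp: algebra_simps)
  then show ?case using step2 subgrp_diff assms by metis
qed

text \<open>A labelling with \<open>D\<close> labels witnesses that \<open>H\<close> has index at most \<open>D\<close>.\<close>

definition labelling :: "'a::ab_group_add set \<Rightarrow> nat \<Rightarrow> ('a \<Rightarrow> nat) \<Rightarrow> bool" where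
  "labelling H D lab \<longleftrightarrow> (\<forall>x. lab x < D) \<and> (\<forall>x y. lab x = lab y \<longrightarrow> x - y \<in> H)"

definition exact_labelling :: "'a::ab_group_add set \<Rightarrow> nat \<Rightarrow> ('a \<Rightarrow> nat) \<Rightarrow> bool" where
  "exact_labelling H D lab \<longleftrightarrow> (\<forall>x. lab x < D) \<and> (\<forall>x y. lab x = lab y \<longleftrightarrow> x - y \<in> H)"

text \<open>Relabel each element by the label of a representative chosen once for its coset; this
  merges the labels that split a coset.\<close>

lemma exact_labelling_exists:
  assumes H: "subgrp H" and lab: "labelling H D lab"
  shows "\<exists>lab'. exact_labelling H D lab'"
proof -
  define r where "r x = (SOME y. y - x \<in> H)" for x
  have r: "r x - x \<in> H" for x
    unfolding r_def by (rule someI[of _ x]) (simp add: subgrp_zero[OF H])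
  have eq: "r x = r y" if "x - y \<in> H" for x y
  proof -
    have "(\<lambda>z. z - x \<in> H) = (\<lambda>z. z - y \<in> H)"
    proof
      fix z
      have "(z - y) - (z - x) \<in> H" using that by simp
      then show "z - x \<in> H \<longleftrightarrow> z - y \<in> H" using subgrp_mem_cong[OF H] by blast
    qed
    then show ?thesis unfolding r_def by simp
  qed
  have "lab (r x) = lab (r y) \<longleftrightarrow> x - y \<in> H" for x y
  proof
    assume "lab (r x) = lab (r y)"
    then have "r x - r y \<in> H" using lab by (auto simp: labelling_def)
    from subgrp_add[OF H subgrp_diff[OF H this r[of x]] r[of y]] show "x - y \<in> H" by simp
  qed (use eq in auto)
  then show ?thesis
    using lab by (intro exI[of _ "\<lambda>x. lab (r x)"]) (auto simp: labelling_def exact_labelling_def)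
qed

text \<open>A set is dissociated modulo \<open>H\<close> if its subset sums are pairwise incongruent. A largest
  dissociated set generates, as an element outside the generated subgroup could be added to it.\<close>

definition dissociated :: "'a::ab_group_add set \<Rightarrow> 'a set \<Rightarrow> bool" where
  "dissociated H J \<longleftrightarrow> (\<forall>T\<subseteq>J. \<forall>U\<subseteq>J. \<Sum>T - \<Sum>U \<in> H \<longrightarrow> T = U)"

text \<open>The subset sums lie in distinct cosets, so their labels are \<open>2 ^ card J\<close>
  distinct numbers below \<open>D\<close>.\<close>

lemma dissociated_card:
  assumes "labelling H D lab" "finite J" "dissociated H J"
  shows "2 ^ card J \<le> D"
proof -
  have "inj_on (\<lambda>T. lab (\<Sum>T)) (Pow J)"
    using assms by (auto simp: inj_on_def labelling_def dissociated_def)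
  moreover have "(\<lambda>T. lab (\<Sum>T)) ` Pow J \<subseteq> {..<D}"
    using assms by (auto simp: labelling_def)
  ultimately have "card (Pow J) \<le> card {..<D}"
    by (rule card_inj_on_le) simp
  then show ?thesis using assms by (simp add: card_Pow)
qed

text \<open>Applied twice: with unit vectors as \<open>S\<close>, to find few generators of the
  quotient by a lattice, and with reduced vectors of a subgroup as \<open>S\<close>, to count
  subgroups.\<close>

lemma small_generating_set:
  assumes H: "subgrp H" and lab: "labelling H D lab"
  obtains J where "J \<subseteq> S" "finite J" "2 ^ card J \<le> D" "S \<subseteq> subgrp hull (J \<union> H)"
proof -
  define P where "P J \<longleftrightarrow> J \<subseteq> S \<and> finite J \<and> dissociated H J" for J
  have P0: "P {}" by (auto simp: P_def dissociated_def)
  \<comment> \<open>This crude bound secures that a largest dissociated set exists.\<close>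
  have "card J \<le> D" if "P J" for J
    using dissociated_card[OF lab] that less_exp[of "card J"] unfolding P_def
    by (meson less_imp_le_nat order_trans)
  then obtain J where J: "P J" and max: "\<And>J'. P J' \<Longrightarrow> card J' \<le> card J"
    using ex_has_greatest_nat[of P "{}" card "Suc D"] P0 by (metis le_imp_less_Suc)
  let ?G = "subgrp hull (J \<union> H)"
  note G = subgrp_hull[of "J \<union> H"]
  have sub: "J \<subseteq> ?G" "H \<subseteq> ?G" using hull_subset[of "J \<union> H" subgrp] by auto
  have sumG: "\<Sum>T \<in> ?G" if "T \<subseteq> J" for T
    by (rule subgrp_sum[OF G]) (use that sub in auto)
  have "s \<in> ?G" if s: "s \<in> S" for s
  proof (rule ccontr)
    assume ns: "s \<notin> ?G"
    then have sJ: "s \<notin> J" using sub by auto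
    \<comment> \<open>A relation containing \<open>s\<close> on one side only would express
      \<open>s\<close> by elements of \<open>J\<close> and \<open>H\<close>.\<close>
    have key: False if "T \<subseteq> J" "U \<subseteq> J" "s + \<Sum>T - \<Sum>U \<in> H" for T U
    proof -
      have "(s + \<Sum>T - \<Sum>U) + (\<Sum>U - \<Sum>T) \<in> ?G"
        by (rule subgrp_add[OF G _ subgrp_diff[OF G]]) (use that sub sumG in auto)
      then show False using ns by simp
    qed
    have fin: "finite T" if "T \<subseteq> J" for T using that J finite_subset by (auto simp: P_def)
    have "dissociated H (insert s J)"
      unfolding dissociated_def
    proof (intro allI impI)
      fix T U assume T: "T \<subseteq> insert s J" and U: "U \<subseteq> insert s J" and d: "\<Sum>T - \<Sum>U \<in> H"
      have T': "T - {s} \<subseteq> J" and U': "U - {s} \<subseteq> J" using T U by auto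
      have st: "\<Sum>T = (if s \<in> T then s else 0) + \<Sum>(T - {s})" 
        using fin[OF T'] sum.remove[of T s "\<lambda>x. x"] by simp
      have su: "\<Sum>U = (if s \<in> U then s else 0) + \<Sum>(U - {s})" 
        using fin[OF U'] sum.remove[of U s "\<lambda>x. x"] by simp
      consider "s \<in> T \<longleftrightarrow> s \<in> U" | "s \<in> T" "s \<notin> U" | "s \<notin> T" "s \<in> U" by auto
      then show "T = U"
      proof cases
        case 1
        then have "\<Sum>(T - {s}) - \<Sum>(U - {s}) \<in> H" using d unfolding st su by (simp split: if_splits)
        then have "T - {s} = U - {s}" using J T' U' by (auto simp: P_def dissociated_def)
        then show ?thesis using 1 by auto
      next
        case 2
        then show ?thesis using key[OF T' U'] d unfolding st su by simp
      next
        case 3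
        have "\<Sum>U - \<Sum>T \<in> H" using d subgrp_minus_commute[OF H] by blast
        then show ?thesis using 3 key[OF U' T'] unfolding st su by simp
      qed
    qed
    then have "P (insert s J)" using J s by (auto simp: P_def)
    from max[OF this] sJ J show False by (auto simp: P_def)
  qed
  then show ?thesis using that[of J] J dissociated_card[OF lab] by (auto simp: P_def)
qed

section \<open>The lattice \<open>B \<int>^n\<close> and the bound \<open>\<bar>det B\<bar>\<close>
  for its index\<close>

lemma mult_mat_vec_index_sum:
  assumes "A \<in> carrier_mat n m" "x \<in> carrier_vec m" "i < n"
  shows "(A *\<^sub>v x) $ i = (\<Sum>k<m. A $$ (i, k) * x $ k)"
  using assms by (simp add: scalar_prod_def lessThan_atLeast0)

text \<open>Integer vectors are functions on \<open>nat\<close>. Membership ignores the coordinates from \<open>n\<close> on, so the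
  quotient of all functions by \<open>latt n B\<close> is \<open>\<int>\<^sup>n / B \<int>\<^sup>n\<close>.\<close>

definition latt :: "nat \<Rightarrow> int mat \<Rightarrow> (nat \<Rightarrow> int) set" where
  "latt n B = {y. \<exists>x\<in>carrier_vec n. vec n y = B *\<^sub>v x}"

lemma lattI: "B \<in> carrier_mat n n \<Longrightarrow> x \<in> carrier_vec n \<Longrightarrow> (\<And>i. i < n \<Longrightarrow> y i = (B *\<^sub>v x) $ i) \<Longrightarrow> y \<in> latt n B"
  unfolding latt_def by (auto intro!: bexI[of _ x] eq_vecI)

lemma lattE:
  assumes "y \<in> latt n B" "B \<in> carrier_mat n n"
  obtains x where "x \<in> carrier_vec n" "\<And>i. i < n \<Longrightarrow> y i = (B *\<^sub>v x) $ i"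
  using assms that unfolding latt_def by (smt (verit, best) index_vec mem_Collect_eq)

lemma subgrp_latt:
  assumes B: "B \<in> carrier_mat n n"
  shows "subgrp (latt n B)"
  unfolding subgrp_def
proof (intro conjI ballI)
  show "0 \<in> latt n B" by (rule lattI[OF B, of "0\<^sub>v n"]) (use B in auto)
  fix y z assume "y \<in> latt n B" "z \<in> latt n B"
  then obtain x u where "x \<in> carrier_vec n" "u \<in> carrier_vec n"
    "\<And>i. i < n \<Longrightarrow> y i = (B *\<^sub>v x) $ i" "\<And>i. i < n \<Longrightarrow> z i = (B *\<^sub>v u) $ i"
    using B by (metis lattE)
  then show "y - z \<in> latt n B"
    by (intro lattI[OF B, of "x - u"]) (use B in \<open>auto simp: mult_minus_distrib_mat_vec\<close>)
qed

text \<open>Since \<open>B * adj_mat B\<close> is \<open>det B\<close> times the identity, the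
  adjugate supplies the preimage; the sign of \<open>det B\<close> is moved into
  \<open>u\<close>.\<close>

lemma latt_det_mult:
  assumes B: "B \<in> carrier_mat n n" and d: "\<bar>det B\<bar> = int d"
  shows "(\<lambda>i. int d * y i) \<in> latt n B"
proof (rule lattI[OF B])
  define u where "u = vec n (\<lambda>i. sgn (det B) * y i)"
  have u: "u \<in> carrier_vec n" by (simp add: u_def)
  note adj = adj_mat[OF B]
  show "adj_mat B *\<^sub>v u \<in> carrier_vec n" using adj u by auto
  have "B *\<^sub>v (adj_mat B *\<^sub>v u) = det B \<cdot>\<^sub>m 1\<^sub>m n *\<^sub>v u"
    using assoc_mult_mat_vec[OF B adj(1) u] adj(2) by simp
  also have "\<dots> = det B \<cdot>\<^sub>v (1\<^sub>m n *\<^sub>v u)" using u by auto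
  also have "\<dots> = det B \<cdot>\<^sub>v u" using u by simp
  finally show "int d * y i = (B *\<^sub>v (adj_mat B *\<^sub>v u)) $ i" if "i < n" for i
    using that d by (simp add: u_def mult.assoc[symmetric] abs_sgn del: index_mult_mat_vec)
qed

text \<open>Cauchy's theorem by descent: split \<open>d = q * e\<close> with \<open>q\<close> prime;
  either \<open>e\<close> times \<open>y\<close> is the wanted element, or it lies in
  \<open>H\<close> and \<open>e\<close> replaces \<open>d\<close>.\<close>

lemma prime_order_element:
  fixes y :: "nat \<Rightarrow> int"
  assumes "y \<notin> H" "(\<lambda>i. int d * y i) \<in> H" "d > 0"
  shows "\<exists>q z. prime (q::nat) \<and> z \<notin> H \<and> (\<lambda>i. int q * z i) \<in> H"
  using assms
proof (induction d rule: less_induct)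
  case (less d)
  have "d \<noteq> 1" using less.prems by auto
  then obtain q where q: "prime q" "q dvd d" using prime_factor_nat by blast
  then obtain e where d: "d = q * e" by auto
  have e: "e > 0" "e < d" using less.prems(3) d prime_gt_1_nat[OF q(1)] by auto
  show ?case
  proof (cases "(\<lambda>i. int e * y i) \<in> H")
    case True
    then show ?thesis using less.IH e less.prems by blast
  next
    case False
    moreover have "(\<lambda>i. int q * (int e * y i)) \<in> H"
      using less.prems(2) d by (simp add: mult.assoc)
    ultimately show ?thesis using q by blast
  qed
qed

lemma labelling_latt_UNIV: "latt n B = UNIV \<Longrightarrow> d > 0 \<Longrightarrow> labelling (latt n B) d (\<lambda>_. 0)"
  by (simp add: labelling_def)

text \<open>Modulo \<open>H\<close>, the elements of \<open>H'\<close> are multiples of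
  \<open>y\<close>, and these depend only on the factor modulo \<open>q\<close>. The new label packs
  the old one and that residue into one number in base \<open>q\<close>.\<close>

lemma labelling_extension:
  fixes y :: "nat \<Rightarrow> int"
  assumes H: "subgrp H" and lab: "labelling H' d lab" and q: "q > 0" "(\<lambda>i. int q * y i) \<in> H"
    and ext: "\<And>z. z \<in> H' \<Longrightarrow> \<exists>k. z - (\<lambda>i. k * y i) \<in> H"
  shows "\<exists>lab'. labelling H (d * q) lab'"
proof -
  define r where "r l = (SOME z. lab z = l)" for l
  have "lab (r (lab z)) = lab z" for z unfolding r_def by (rule someI[of _ z]) simp
  then have "z - r (lab z) \<in> H'" for z using lab by (auto simp: labelling_def)
  then have "\<exists>k. z - r (lab z) - (\<lambda>i. k * y i) \<in> H" for z using ext by blast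
  then obtain k where k: "\<And>z. z - r (lab z) - (\<lambda>i. k z * y i) \<in> H" by metis
  have k': "z - r (lab z) - (\<lambda>i. k z mod int q * y i) \<in> H" for z
  proof -
    have "(\<lambda>i. (k z div int q) * (int q * y i)) \<in> H" by (rule subgrp_mult[OF H q(2)])
    from subgrp_add[OF H k[of z] this]
    show ?thesis
      by (rule back_subst[of "\<lambda>v. v \<in> H"])
        (auto simp: fun_eq_iff minus_div_mult_eq_mod[symmetric] algebra_simps)
  qed
  define f where "f z = lab z * q + nat (k z mod int q)" for z
  have kq: "nat (k z mod int q) < q" for z using q by (simp add: nat_less_iff)
  have "f z < d * q" for z
  proof -
    have "f z < (lab z + 1) * q" using kq[of z] by (simp add: f_def)
    also have "\<dots> \<le> d * q" using lab by (intro mult_right_mono) (auto simp: labelling_def Suc_le_eq)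
    finally show ?thesis .
  qed
  moreover have "z - w \<in> H" if "f z = f w" for z w
  proof -
    have "lab z = f z div q" "lab w = f w div q" "nat (k z mod int q) = f z mod q" "nat (k w mod int q) = f w mod q"
      using kq[of z] kq[of w] by (simp_all add: f_def)
    then have "lab z = lab w" "nat (k z mod int q) = nat (k w mod int q)" using that by simp_all
    then have "lab z = lab w" "k z mod int q = k w mod int q" using q by (auto simp: eq_nat_nat_iff)
    then show ?thesis using subgrp_diff[OF H k'[of z] k'[of w]] by simp
  qed
  ultimately show ?thesis unfolding labelling_def by blast
qed

text \<open>Induction on \<open>\<bar>det B\<bar>\<close>: if \<open>q\<close> is prime and \<open>q y = B x\<close> for a \<open>y\<close> outside the lattice, normalise
  some \<open>x\<^sub>j\<close> to \<open>1\<close> and replace column \<open>j\<close> of \<open>B\<close> by \<open>y\<close>. By Cramer's rule this divides the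
  determinant by \<open>q\<close>, and the lattice grows by a cyclic group of order \<open>q\<close>.\<close>

lemma latt_labelling:
  assumes "B \<in> carrier_mat n n" "\<bar>det B\<bar> = int d" "d > 0"
  shows "\<exists>lab. labelling (latt n B) d lab"
  using assms
proof (induction d arbitrary: B rule: less_induct)
  case (less d)
  note B = less.prems(1)
  note H = subgrp_latt[OF B]
  show ?case
  proof (cases "latt n B = UNIV")
    case True
    then show ?thesis using labelling_latt_UNIV less.prems by blast
  next
    case False
    then obtain y0 where "y0 \<notin> latt n B" by blast
    then obtain q y where q: "prime (q::nat)" and y: "y \<notin> latt n B" and qy: "(\<lambda>i. int q * y i) \<in> latt n B"
      using prime_order_element latt_det_mult[OF B less.prems(2)] less.prems(3) by metis
    obtain x where x: "x \<in> carrier_vec n" "\<And>i. i < n \<Longrightarrow> int q * y i = (B *\<^sub>v x) $ i"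
      using lattE[OF qy B] by metis
    have q0: "q > 0" "q > 1" using q prime_gt_0_nat prime_gt_1_nat by auto
    \<comment> \<open>Otherwise \<open>x\<close> could be divided by \<open>q\<close>, giving a
      preimage of \<open>y\<close> itself.\<close>
    have "\<exists>j<n. \<not> int q dvd x $ j"
    proof (rule ccontr)
      assume "\<not> (\<exists>j<n. \<not> int q dvd x $ j)"
      then have dvd: "int q dvd x $ j" if "j < n" for j using that by blast
      have "y \<in> latt n B"
      proof (rule lattI[OF B, of "vec n (\<lambda>j. x $ j div int q)"])
        fix i assume i: "i < n"
        have "int q * y i = (\<Sum>k<n. B $$ (i, k) * x $ k)"
          using x i B by (simp add: mult_mat_vec_index_sum[of _ n n] del: index_mult_mat_vec)
        also have "\<dots> = int q * (\<Sum>k<n. B $$ (i, k) * (x $ k div int q))"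
          unfolding sum_distrib_left by (rule sum.cong) (use dvd in \<open>auto simp: mult.left_commute\<close>)
        finally show "y i = (B *\<^sub>v vec n (\<lambda>j. x $ j div int q)) $ i"
          using q0 i B by (simp add: mult_mat_vec_index_sum[of _ n n] del: index_mult_mat_vec)
      qed simp
      then show False using y by simp
    qed
    then obtain j where j: "j < n" "\<not> int q dvd x $ j" by blast
    then have "coprime (x $ j) (int q)"
      using q by (simp add: prime_imp_coprime coprime_commute)
    then obtain u k' where "u * x $ j + k' * int q = 1"
      using bezout_int[of "x $ j" "int q"] by (auto simp: coprime_iff_gcd_eq_1)
    then have k: "x $ j * u = 1 + int q * (- k')" by (simp add: algebra_simps)
    \<comment> \<open>With \<open>u\<close> inverse to \<open>x $ j\<close> modulo \<open>q\<close>,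
      scaling \<open>y\<close> by \<open>u\<close> and subtracting \<open>k\<close> times column
      \<open>j\<close> of \<open>B\<close> makes the coefficient of that column exactly 1.\<close>
    define k where "k = - k'"
    define y2 where "y2 i = u * y i - k * B $$ (i, j)" for i
    define x2 where "x2 i = u * x $ i - (if i = j then int q * k else 0)" for i
    have x2j: "x2 j = 1" using k by (simp add: k_def x2_def algebra_simps)
    have qy2: "int q * y2 i = (\<Sum>l<n. B $$ (i, l) * x2 l)" if i: "i < n" for i
    proof -
      have "int q * y2 i = u * (\<Sum>l<n. B $$ (i, l) * x $ l) - int q * k * B $$ (i, j)"
        using x(2)[OF i] x(1) i B
        by (simp add: mult_mat_vec_index_sum[of _ n n] y2_def algebra_simps del: index_mult_mat_vec)
      also have "\<dots> = (\<Sum>l<n. B $$ (i, l) * (u * x $ l)) - (\<Sum>l<n. B $$ (i, l) * (if l = j then int q * k else 0))"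
        using j by (simp add: sum_distrib_left mult_ac if_distrib cong: if_cong)
      also have "\<dots> = (\<Sum>l<n. B $$ (i, l) * x2 l)"
        by (simp add: x2_def sum_subtractf right_diff_distrib)
      finally show ?thesis .
    qed
    define B' where "B' = replace_col B (vec n y2) j"
    have B': "B' \<in> carrier_mat n n" using B by (simp add: B'_def replace_col_def)
    have B'_index: "B' $$ (i, l) = (if l = j then y2 i else B $$ (i, l))" if "i < n" "l < n" for i l
      using that B by (simp add: B'_def replace_col_def)
    \<comment> \<open>Solving \<open>q y2 = B x2\<close> for column \<open>j\<close> of
      \<open>B\<close> gives its coordinates in the columns of \<open>B'\<close>; entry
      \<open>j\<close> is \<open>q\<close>, the factor that Cramer's rule yields.\<close>
    define w where "w = vec n (\<lambda>i. if i = j then int q else - x2 i)"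
    have "replace_col B' (B' *\<^sub>v w) j = B"
    proof (rule eq_matI)
      fix i l assume "i < dim_row B" "l < dim_col B"
      then have i: "i < n" "l < n" using B by auto
      have "(B' *\<^sub>v w) $ i = (\<Sum>l<n. B' $$ (i, l) * w $ l)"
        using i B' by (subst mult_mat_vec_index_sum[of _ n n]) (auto simp: w_def)
      also have "\<dots> = y2 i * int q - (\<Sum>l\<in>{..<n} - {j}. B $$ (i, l) * x2 l)"
        using j i by (subst sum.remove[of _ j]) (auto simp: B'_index w_def sum_negf[symmetric])
      also have "\<dots> = B $$ (i, j)"
        using qy2[OF i(1)] j x2j sum.remove[of "{..<n}" j "\<lambda>l. B $$ (i, l) * x2 l"] by (simp add: mult.commute)
      finally show "replace_col B' (B' *\<^sub>v w) j $$ (i, l) = B $$ (i, l)"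
        using i B' B'_index by (simp add: replace_col_def)
    qed (use B B' in \<open>auto simp: replace_col_def\<close>)
    then have "det B = int q * det B'"
      using cramer_lemma_mat[OF B' _ j(1), of w] j by (simp add: w_def)
    then have d: "int d = int q * \<bar>det B'\<bar>" using less.prems(2) by (simp add: abs_mult)
    define d' where "d' = nat \<bar>det B'\<bar>"
    have d': "d = d' * q" "\<bar>det B'\<bar> = int d'" 
    proof -
      show "\<bar>det B'\<bar> = int d'" by (simp add: d'_def)
      then have "int d = int (d' * q)" using d by simp
      then show "d = d' * q" using of_nat_eq_iff by blast
    qed
    then have "d' > 0" "d' < d" using less.prems(3) q0 by auto
    then obtain lab where lab: "labelling (latt n B') d' lab" using less.IH B' d' by blast
    have "(\<lambda>i. int q * y2 i) \<in> latt n B"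
      by (rule lattI[OF B, of "vec n x2"])
        (use qy2 B in \<open>auto simp: mult_mat_vec_index_sum[of _ n n] simp del: index_mult_mat_vec\<close>)
    \<comment> \<open>The columns other than \<open>j\<close> are common to \<open>B\<close> and
      \<open>B'\<close>, so \<open>z\<close> is congruent to its coefficient at \<open>j\<close>
      times \<open>y2\<close>.\<close>
    moreover have "\<exists>k. z - (\<lambda>i. k * y2 i) \<in> latt n B" if z: "z \<in> latt n B'" for z
    proof -
      obtain v where v: "v \<in> carrier_vec n" "\<And>i. i < n \<Longrightarrow> z i = (B' *\<^sub>v v) $ i"
        using lattE[OF z B'] by metis
      have "z - (\<lambda>i. v $ j * y2 i) \<in> latt n B"
      proof (rule lattI[OF B, of "vec n (\<lambda>i. if i = j then 0 else v $ i)"])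
        fix i assume i: "i < n"
        have "z i = (\<Sum>l<n. B' $$ (i, l) * v $ l)"
          using v i B' by (simp add: mult_mat_vec_index_sum[of _ n n] del: index_mult_mat_vec)
        also have "\<dots> = y2 i * v $ j + (\<Sum>l\<in>{..<n} - {j}. B $$ (i, l) * v $ l)"
          using i j by (subst sum.remove[of _ j]) (auto simp: B'_index)
        also have "(\<Sum>l\<in>{..<n} - {j}. B $$ (i, l) * v $ l) =
            (\<Sum>l<n. B $$ (i, l) * (if l = j then 0 else v $ l))"
          by (rule sum.mono_neutral_cong_left) auto
        finally show "(z - (\<lambda>i. v $ j * y2 i)) i = (B *\<^sub>v vec n (\<lambda>i. if i = j then 0 else v $ i)) $ i"
          using i B by (simp add: mult_mat_vec_index_sum[of _ n n] mult.commute del: index_mult_mat_vec)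
      qed simp
      then show ?thesis by blast
    qed
    ultimately show ?thesis using labelling_extension[OF H lab q0(1)] d' by blast
  qed
qed

section \<open>Standard form of the simplices and integer equivalence\<close>

text \<open>The final inequality stands for the row outside \<open>B\<close>, multiplied by
  \<open>d\<close> and expressed in the slacks \<open>bet - B x\<close>.\<close>

definition std_simplex :: "nat \<Rightarrow> int mat \<Rightarrow> (nat \<Rightarrow> int) \<Rightarrow> (nat \<Rightarrow> int) \<Rightarrow> int \<Rightarrow> real vec set" where
  "std_simplex n B lam bet N = {x \<in> carrier_vec n. (\<forall>i<n. (real_mat B *\<^sub>v x) $ i \<le> of_int (bet i)) \<and>
     (\<Sum>i<n. of_int (lam i) * (of_int (bet i) - (real_mat B *\<^sub>v x) $ i)) \<le> of_int N}"

text \<open>Serves both for square submatrices, with \<open>s\<close> selecting from more than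
  \<open>n\<close> rows, and for reorderings, with \<open>s\<close> a permutation.\<close>

definition select_rows :: "nat \<Rightarrow> (nat \<Rightarrow> nat) \<Rightarrow> int mat \<Rightarrow> int mat" where
  "select_rows n s B = mat n n (\<lambda>(i, j). B $$ (s i, j))"

lemma select_rows_carrier: "select_rows n s B \<in> carrier_mat n n"
  by (simp add: select_rows_def)

lemma abs_det_permute_rows:
  assumes "B \<in> carrier_mat n n" "s permutes {..<n}"
  shows "\<bar>det (select_rows n s B)\<bar> = \<bar>det B\<bar>"
  using det_permute_rows[OF assms(1), of s] assms(2)
  by (simp add: select_rows_def lessThan_atLeast0 abs_mult sign_def)

lemma mult_permute_rows:
  assumes B: "B \<in> carrier_mat n n" and s: "s permutes {..<n}"
    and x: "x \<in> carrier_vec n" and i: "i < n"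
  shows "(select_rows n s B *\<^sub>v x) $ i = (B *\<^sub>v x) $ s i"
    and "x' \<in> carrier_vec n \<Longrightarrow> (real_mat (select_rows n s B) *\<^sub>v x') $ i = (real_mat B *\<^sub>v x') $ s i"
proof -
  have si: "s i < n" using permutes_in_image[OF s, of i] i by simp
  show "(select_rows n s B *\<^sub>v x) $ i = (B *\<^sub>v x) $ s i"
    using assms si by (simp add: mult_mat_vec_index_sum[of _ n n] select_rows_def del: index_mult_mat_vec)
  show "(real_mat (select_rows n s B) *\<^sub>v x') $ i = (real_mat B *\<^sub>v x') $ s i" if "x' \<in> carrier_vec n"
    using assms si that by (simp add: mult_mat_vec_index_sum[of _ n n] select_rows_def del: index_mult_mat_vec)
qed

lemma std_simplex_permute_rows:
  assumes B: "B \<in> carrier_mat n n" and s: "s permutes {..<n}"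
  shows "std_simplex n (select_rows n s B) (lam \<circ> s) (bet \<circ> s) N = std_simplex n B lam bet N"
proof -
  have "(\<forall>i<n. (real_mat (select_rows n s B) *\<^sub>v x) $ i \<le> of_int ((bet \<circ> s) i)) \<longleftrightarrow>
     (\<forall>i<n. (real_mat B *\<^sub>v x) $ i \<le> of_int (bet i))" (is "?l \<longleftrightarrow> ?r") if x: "x \<in> carrier_vec n" for x
  proof -
    have "?l \<longleftrightarrow> (\<forall>i\<in>{..<n}. (real_mat B *\<^sub>v x) $ s i \<le> of_int (bet (s i)))"
      using mult_permute_rows(2)[OF B s zero_carrier_vec _ x] by auto
    also have "\<dots> \<longleftrightarrow> (\<forall>i\<in>s ` {..<n}. (real_mat B *\<^sub>v x) $ i \<le> of_int (bet i))" by blast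
    finally show ?thesis by (simp only: permutes_image[OF s] Ball_def lessThan_iff)
  qed
  moreover have "(\<Sum>i<n. of_int ((lam \<circ> s) i) * (of_int ((bet \<circ> s) i) - (real_mat (select_rows n s B) *\<^sub>v x) $ i)) =
     (\<Sum>i<n. of_int (lam i) * (of_int (bet i) - (real_mat B *\<^sub>v x) $ i))" if x: "x \<in> carrier_vec n" for x
    using mult_permute_rows(2)[OF B s zero_carrier_vec _ x]
    by (subst sum.permute[OF s]) (auto intro!: sum.cong)
  ultimately show ?thesis unfolding std_simplex_def by auto
qed

lemma latt_permute_rows:
  assumes B: "B \<in> carrier_mat n n" and s: "s permutes {..<n}"
  shows "y \<in> latt n (select_rows n s B) \<longleftrightarrow> y \<circ> inv_into UNIV s \<in> latt n B"
proof
  assume "y \<in> latt n (select_rows n s B)"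
  then obtain x where x: "x \<in> carrier_vec n" "\<And>i. i < n \<Longrightarrow> y i = (select_rows n s B *\<^sub>v x) $ i"
    using lattE select_rows_carrier by metis
  show "y \<circ> inv_into UNIV s \<in> latt n B"
  proof (rule lattI[OF B x(1)])
    fix i assume i: "i < n"
    then have "inv_into UNIV s i < n" using permutes_in_image[OF permutes_inv[OF s], of i] by simp
    then show "(y \<circ> inv_into UNIV s) i = (B *\<^sub>v x) $ i"
      using x mult_permute_rows(1)[OF B s x(1)] permutes_inverses[OF s] by simp
  qed
next
  assume "y \<circ> inv_into UNIV s \<in> latt n B"
  then obtain x where x: "x \<in> carrier_vec n" "\<And>i. i < n \<Longrightarrow> (y \<circ> inv_into UNIV s) i = (B *\<^sub>v x) $ i"
    using lattE B by metis
  show "y \<in> latt n (select_rows n s B)"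
  proof (rule lattI[OF select_rows_carrier x(1)])
    fix i assume i: "i < n"
    then have si: "s i < n" using permutes_in_image[OF s, of i] by simp
    show "y i = (select_rows n s B *\<^sub>v x) $ i"
      using x(2)[OF si] mult_permute_rows(1)[OF B s x(1) i] permutes_inverses[OF s] by simp
  qed
qed

text \<open>Inclusion of the lattices gives \<open>B = B' * U\<close>, and equality of determinants
  up to sign makes \<open>U\<close> unimodular. With \<open>B' q = bet' - bet\<close>, the map
  \<open>U x + q\<close> preserves every slack.\<close>

lemma std_simplex_equivalent:
  assumes B: "B \<in> carrier_mat n n" and B': "B' \<in> carrier_mat n n"
    and det: "\<bar>det B\<bar> = \<bar>det B'\<bar>" "det B \<noteq> 0"
    and latt: "latt n B \<subseteq> latt n B'" and bet: "bet' - bet \<in> latt n B'"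
    and lam: "\<And>i. i < n \<Longrightarrow> lam i = lam' i"
  shows "(std_simplex n B lam bet N, std_simplex n B' lam' bet' N) \<in> integer_equivalence n"
proof -
  \<comment> \<open>The columns of \<open>B\<close> lie in \<open>latt n B'\<close>; their preimages
    under \<open>B'\<close> become the columns of \<open>U\<close>.\<close>
  have "\<exists>u\<in>carrier_vec n. \<forall>i<n. B $$ (i, j) = (B' *\<^sub>v u) $ i" if j: "j < n" for j
  proof -
    have "(\<lambda>i. B $$ (i, j)) \<in> latt n B"
      by (rule lattI[OF B, of "unit_vec n j"]) (use B j in \<open>auto simp: scalar_prod_right_unit\<close>)
    then have "(\<lambda>i. B $$ (i, j)) \<in> latt n B'" using latt by blast
    from lattE[OF this B'] show ?thesis by auto
  qed
  then obtain u where u: "\<And>j. j < n \<Longrightarrow> u j \<in> carrier_vec n"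
    "\<And>i j. j < n \<Longrightarrow> i < n \<Longrightarrow> B $$ (i, j) = (B' *\<^sub>v u j) $ i" by metis
  define U where "U = mat n n (\<lambda>(i, j). u j $ i)"
  have U: "U \<in> carrier_mat n n" by (simp add: U_def)
  have BU: "B = B' * U"
  proof (rule eq_matI)
    fix i j assume "i < dim_row (B' * U)" "j < dim_col (B' * U)"
    then have ij: "i < n" "j < n" using B' U by auto
    have "col U j = u j" using ij u(1)[of j] by (auto simp: U_def intro!: eq_vecI)
    then show "B $$ (i, j) = (B' * U) $$ (i, j)" using ij u(2)[of j i] B' U by simp
  qed (use B B' U in auto)
  then have "\<bar>det B'\<bar> * \<bar>det U\<bar> = \<bar>det B'\<bar>" using det(1) det_mult[OF B' U] by (simp add: abs_mult)
  then have detU: "\<bar>det U\<bar> = 1" using det by auto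
  obtain q where q: "q \<in> carrier_vec n" "\<And>i. i < n \<Longrightarrow> (bet' - bet) i = (B' *\<^sub>v q) $ i"
    using lattE[OF bet B'] by metis
  let ?T = "\<lambda>x. real_mat U *\<^sub>v x + real_vec q"
  have T: "?T x \<in> carrier_vec n" if "x \<in> carrier_vec n" for x using that U q by auto
  have index: "(real_mat B' *\<^sub>v ?T x) $ i = (real_mat B *\<^sub>v x) $ i + of_int (bet' i) - of_int (bet i)"
    if x: "x \<in> carrier_vec n" and i: "i < n" for x i
  proof -
    have "real_mat B' *\<^sub>v ?T x = real_mat B *\<^sub>v x + real_vec (B' *\<^sub>v q)"
      using B' U q x
      by (subst mult_add_distrib_mat_vec[of _ n n])
        (auto simp: BU of_int_hom.mat_hom_mult[of _ n n _ n] of_int_hom.mult_mat_vec_hom[of _ n n] assoc_mult_mat_vec[of _ n n _ n])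
    moreover have "(B' *\<^sub>v q) $ i = bet' i - bet i" using q(2)[OF i] by simp
    ultimately show ?thesis using i B B' q(1) x by (simp del: index_mult_mat_vec)
  qed
  have mem: "?T x \<in> std_simplex n B' lam' bet' N \<longleftrightarrow> x \<in> std_simplex n B lam bet N"
    if x: "x \<in> carrier_vec n" for x
  proof -
    have "(\<Sum>i<n. of_int (lam' i) * (of_int (bet' i) - (real_mat B' *\<^sub>v ?T x) $ i)) =
       (\<Sum>i<n. of_int (lam i) * (of_int (bet i) - (real_mat B *\<^sub>v x) $ i))"
      by (rule sum.cong) (use index[OF x] lam in auto)
    then show ?thesis using index[OF x] T[OF x] x by (auto simp: std_simplex_def)
  qed
  \<comment> \<open>As \<open>det U\<close> is 1 or -1, this is an integer inverse of
    \<open>U\<close>; it gives surjectivity.\<close>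
  define R where "R = det U \<cdot>\<^sub>m adj_mat U"
  have d: "det U * det U = 1" using detU by (metis abs_mult_self_eq mult_1)
  have R: "R \<in> carrier_mat n n" using adj_mat(1)[OF U] by (simp add: R_def)
  have UR: "U * R = 1\<^sub>m n"
    using U adj_mat[OF U] d by (auto simp: R_def mult_smult_distrib[of _ n n _ n] intro!: eq_matI)
  have "std_simplex n B' lam' bet' N = ?T ` std_simplex n B lam bet N"
  proof (intro equalityI subsetI)
    fix z assume z: "z \<in> std_simplex n B' lam' bet' N"
    then have zc: "z \<in> carrier_vec n" by (simp add: std_simplex_def)
    define x where "x = real_mat R *\<^sub>v (z - real_vec q)"
    have x: "x \<in> carrier_vec n" using R zc q by (auto simp: x_def)
    have "real_mat U *\<^sub>v x = z - real_vec q"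
      unfolding x_def using U R zc q UR
      by (subst assoc_mult_mat_vec[symmetric, of _ n n _ n]) (auto simp flip: of_int_hom.mat_hom_mult simp: of_int_hom.mat_hom_one)
    then have "?T x = z" using zc q by auto
    then show "z \<in> ?T ` std_simplex n B lam bet N" using mem[OF x] z by force
  next
    fix z assume "z \<in> ?T ` std_simplex n B lam bet N"
    then show "z \<in> std_simplex n B' lam' bet' N" using mem by (auto simp: std_simplex_def)
  qed
  moreover have "std_simplex n B lam bet N \<subseteq> carrier_vec n" by (auto simp: std_simplex_def)
  ultimately show ?thesis
    unfolding integer_equivalence_def using U q detU by auto
qed

section \<open>Maximal minors and Cramer's rule\<close>

lemma submatrix_all_columns:
  assumes A: "A \<in> carrier_mat m n" and I: "I \<subseteq> {..<m}" "card I = n"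
  shows "submatrix A I {..<n} = select_rows n (pick I) A"
proof -
  have "pick {..<n} j = j" if "j < n" for j
  proof -
    have "{a \<in> {..<n}. a < j} = {..<j}" using that by auto
    then show ?thesis using pick_card_in_set[of j "{..<n}"] that by simp
  qed
  moreover have "{i. i < m \<and> i \<in> I} = I" using I by auto
  moreover have "{j. j < n \<and> j \<in> {..<n}} = {..<n}" by auto
  ultimately show ?thesis
    using A I by (auto simp: submatrix_def select_rows_def intro!: eq_matI)
qed

lemma minor_values_finite: "finite {\<bar>det (submatrix A I {..<n})\<bar> | I. I \<subseteq> {..<m::nat} \<and> card I = n}"
proof -
  have "finite {I. I \<subseteq> {..<m} \<and> card I = n}" by (rule finite_subset[of _ "Pow {..<m}"]) auto
  from finite_image_set[OF this] show ?thesis by simp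
qed

lemma max_minor_attained:
  assumes A: "A \<in> carrier_mat m n" and "n \<le> m"
  obtains f where "inj_on f {..<n}" "f ` {..<n} \<subseteq> {..<m}" "\<bar>det (select_rows n f A)\<bar> = max_minor A"
proof -
  let ?M = "{\<bar>det (submatrix A I {..<n})\<bar> | I. I \<subseteq> {..<m} \<and> card I = n}"
  have "{..<n} \<subseteq> {..<m} \<and> card {..<n} = n" using assms by auto
  then have "?M \<noteq> {}" by blast
  from Max_in[OF minor_values_finite this] A
  obtain I where I: "I \<subseteq> {..<m}" "card I = n" "max_minor A = \<bar>det (submatrix A I {..<n})\<bar>"
    unfolding max_minor_def by auto
  have "pick I i \<in> I" if "i < n" for i using pick_in_set_le[of i I] that I by simp
  moreover have "inj_on (pick I) {..<n}"
    using pick_mono_le[of _ I] I by (intro linorder_inj_onI') fastforce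
  ultimately show ?thesis
    using that[of "pick I"] I submatrix_all_columns[OF A I(1,2)] by fastforce
qed

text \<open>A minor in \<open>max_minor\<close> takes its rows in increasing order; an injective
  selection of the same rows is a permutation of it, which affects only the sign.\<close>

lemma abs_det_select_rows_le:
  assumes A: "A \<in> carrier_mat m n" and f: "inj_on f {..<n}" "f ` {..<n} \<subseteq> {..<m}"
  shows "\<bar>det (select_rows n f A)\<bar> \<le> max_minor A"
proof -
  define I where "I = f ` {..<n}"
  have I: "I \<subseteq> {..<m}" "card I = n" "finite I" using f by (auto simp: I_def card_image)
  \<comment> \<open>\<open>s i\<close> is the rank of \<open>f i\<close> within \<open>I\<close>;
    from \<open>n\<close> on it is the identity, as \<open>permutes\<close> requires.\<close>
  define s where "s i = (if i < n then card {a \<in> I. a < f i} else i)" for i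
  have pick: "pick I (s i) = f i" if "i < n" for i
    using that pick_card_in_set[of "f i" I] by (simp add: s_def I_def)
  have "s i < n" if "i < n" for i
  proof -
    have "{a \<in> I. a < f i} \<subset> I" using that by (auto simp: I_def)
    then show ?thesis using that I psubset_card_mono[of I "{a \<in> I. a < f i}"] by (simp add: s_def)
  qed
  then have "s ` {..<n} \<subseteq> {..<n}" by auto
  moreover have "inj_on s {..<n}"
    using f(1) pick unfolding inj_on_def by (metis lessThan_iff)
  ultimately have "bij_betw s {..<n} {..<n}"
    unfolding bij_betw_def by (simp add: endo_inj_surj)
  then have s: "s permutes {..<n}"
    by (rule bij_imp_permutes) (simp add: s_def)
  have "select_rows n f A = select_rows n s (select_rows n (pick I) A)"
    using pick permutes_in_image[OF s]
    by (auto simp: select_rows_def intro!: eq_matI)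
  then have "\<bar>det (select_rows n f A)\<bar> = \<bar>det (submatrix A I {..<n})\<bar>"
    using abs_det_permute_rows[OF select_rows_carrier s] submatrix_all_columns[OF A I(1,2)] by simp
  also have "\<dots> \<le> max_minor A"
    unfolding max_minor_def using A I by (intro Max_ge) (use minor_values_finite in auto)
  finally show ?thesis .
qed

text \<open>Cramer's rule without division: the Laplace expansion along the replaced column uses the
  cofactors of \<open>C\<close>, because they delete that column.\<close>

lemma adj_mat_mult_vec_index:
  fixes C :: "'a::comm_ring_1 mat"
  assumes C: "C \<in> carrier_mat n n" and a: "a \<in> carrier_vec n" and k: "k < n"
  shows "(adj_mat C *\<^sub>v a) $ k = det (replace_col C a k)"
proof -
  have R: "replace_col C a k \<in> carrier_mat n n" using C by (simp add: replace_col_def)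
  have "mat_delete (replace_col C a k) i k = mat_delete C i k" for i
    using C k by (auto simp: replace_col_def mat_delete_def intro!: eq_matI)
  then have "det (replace_col C a k) = (\<Sum>i<n. a $ i * cofactor C i k)"
    using C k by (subst laplace_expansion_column[OF R k]) (auto simp: replace_col_def cofactor_def intro!: sum.cong)
  also have "\<dots> = (adj_mat C *\<^sub>v a) $ k"
    using adj_mat(1)[OF C] a k C
    by (simp add: mult_mat_vec_index_sum[of _ n n] adj_mat_def mult.commute del: index_mult_mat_vec)
  finally show ?thesis by simp
qed

text \<open>The transposed system is solved by Cramer's rule. Its coefficient \<open>w i\<close> is
  the minor in which row \<open>k\<close> takes the place of row \<open>f i\<close>, hence is
  bounded by the largest minor.\<close>

lemma row_combination:
  assumes A: "A \<in> carrier_mat m n" and f: "inj_on f {..<n}" "f ` {..<n} \<subseteq> {..<m}"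
    and k: "k < m" "k \<notin> f ` {..<n}"
  obtains w where "\<And>i. i < n \<Longrightarrow> \<bar>w i\<bar> \<le> max_minor A"
    "\<And>j. j < n \<Longrightarrow> (\<Sum>i<n. w i * A $$ (f i, j)) = det (select_rows n f A) * A $$ (k, j)"
proof -
  define C where "C = transpose_mat (select_rows n f A)"
  have C: "C \<in> carrier_mat n n" by (simp add: C_def select_rows_carrier)
  have C_index: "C $$ (i, j) = A $$ (f j, i)" if "i < n" "j < n" for i j
    using that by (simp add: C_def select_rows_def)
  have detC: "det C = det (select_rows n f A)"
    by (simp add: C_def det_transpose[OF select_rows_carrier])
  define a where "a = vec n (\<lambda>j. A $$ (k, j))"
  have a: "a \<in> carrier_vec n" by (simp add: a_def)
  define w where "w i = (adj_mat C *\<^sub>v a) $ i" for i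
  have "\<bar>w i\<bar> \<le> max_minor A" if i: "i < n" for i
  proof -
    have "transpose_mat (replace_col C a i) = select_rows n (f(i := k)) A"
      using C i C_index by (auto simp: replace_col_def select_rows_def a_def intro!: eq_matI)
    moreover have "replace_col C a i \<in> carrier_mat n n" using C by (simp add: replace_col_def)
    ultimately have "w i = det (select_rows n (f(i := k)) A)"
      using adj_mat_mult_vec_index[OF C a i] det_transpose unfolding w_def by metis
    moreover have "inj_on (f(i := k)) {..<n}" "(f(i := k)) ` {..<n} \<subseteq> {..<m}"
      using f k by (auto simp: inj_on_def)
    ultimately show ?thesis using abs_det_select_rows_le[OF A] by metis
  qed
  moreover have "(\<Sum>i<n. w i * A $$ (f i, j)) = det (select_rows n f A) * A $$ (k, j)" if j: "j < n" for j
  proof -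
    have wv: "adj_mat C *\<^sub>v a \<in> carrier_vec n" using adj_mat(1)[OF C] a by simp
    have "(\<Sum>i<n. w i * A $$ (f i, j)) = (C *\<^sub>v (adj_mat C *\<^sub>v a)) $ j"
      using j wv C by (simp add: mult_mat_vec_index_sum[of C n n] w_def C_index mult.commute del: index_mult_mat_vec)
    also have "C *\<^sub>v (adj_mat C *\<^sub>v a) = det C \<cdot>\<^sub>m 1\<^sub>m n *\<^sub>v a"
      using assoc_mult_mat_vec[OF C adj_mat(1)[OF C] a] adj_mat(2)[OF C] by simp
    also have "\<dots> = det C \<cdot>\<^sub>v (1\<^sub>m n *\<^sub>v a)" using a by auto
    finally show ?thesis using a j detC by (simp add: a_def)
  qed
  ultimately show ?thesis using that by blast
qed

section \<open>From modular simplices to the standard form\<close>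

lemma full_dim_simplex_bounded:
  assumes "full_dim_simplex n S"
  shows "S \<noteq> {}" "\<exists>M. \<forall>x\<in>S. \<forall>j<n. \<bar>x $ j\<bar> \<le> M"
proof -
  obtain V where V: "V \<in> carrier_mat n (n + 1)" and S: "S = convex_hull_cols V"
    using assms by (auto simp: full_dim_simplex_def)
  define m where "m = n + 1"
  then have m: "m > 0" by simp
  note V = V[folded m_def]
  let ?c = "unit_vec (m) 0 :: real vec"
  have "(\<Sum>i<m. ?c $ i) = (\<Sum>i<m. if i = 0 then 1 else 0)"
    using m by (intro sum.cong) auto
  moreover have "0\<^sub>v (m) \<le> ?c" by (simp add: less_eq_vec_def)
  ultimately have "V *\<^sub>v ?c \<in> S"
    unfolding S convex_hull_cols_def using V m by (intro CollectI exI[of _ ?c]) simp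
  then show "S \<noteq> {}" by auto
  have "\<bar>x $ j\<bar> \<le> (\<Sum>i<n. \<Sum>k<m. \<bar>V $$ (i, k)\<bar>)" if x: "x \<in> S" and j: "j < n" for x j
  proof -
    obtain c where c: "c \<in> carrier_vec (m)" "0\<^sub>v (m) \<le> c" "(\<Sum>i<m. c $ i) = 1" "x = V *\<^sub>v c"
      using x unfolding S convex_hull_cols_def carrier_matD[OF V] by blast
    have c0: "0 \<le> c $ i" if "i < m" for i using c that by (auto simp: less_eq_vec_def)
    have c1: "c $ i \<le> 1" if "i < m" for i
      using member_le_sum[of i "{..<m}" "\<lambda>i. c $ i"] c0 that c(3) by auto
    have "\<bar>x $ j\<bar> = \<bar>\<Sum>k<m. V $$ (j, k) * c $ k\<bar>"
      using c V j by (subst c(4), subst mult_mat_vec_index_sum[OF V]) auto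
    also have "\<dots> \<le> (\<Sum>k<m. \<bar>V $$ (j, k) * c $ k\<bar>)" by (rule sum_abs)
    also have "\<dots> \<le> (\<Sum>k<m. \<bar>V $$ (j, k)\<bar>)"
      by (rule sum_mono) (use c0 c1 in \<open>auto simp: abs_mult intro!: mult_left_le\<close>)
    also have "\<dots> \<le> (\<Sum>i<n. \<Sum>k<m. \<bar>V $$ (i, k)\<bar>)"
      using j by (intro member_le_sum[of j "{..<n}" "\<lambda>j. \<Sum>k<m. \<bar>V $$ (j, k)\<bar>"]) (auto intro: sum_nonneg)
    finally show ?thesis .
  qed
  then show "\<exists>M. \<forall>x\<in>S. \<forall>j<n. \<bar>x $ j\<bar> \<le> M" by blast
qed

text \<open>If \<open>lam i \<le> 0\<close>, moving so that only slack \<open>i\<close> grows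
  violates no inequality, so the bounded set would contain a ray.\<close>

lemma std_simplex_lambda_pos:
  assumes B: "B \<in> carrier_mat n n" "\<bar>det B\<bar> = int d" "d > 0"
    and S: "S = std_simplex n B lam bet N" "S \<noteq> {}"
    and M: "\<And>x j. x \<in> S \<Longrightarrow> j < n \<Longrightarrow> \<bar>x $ j\<bar> \<le> M"
    and i: "i < n"
  shows "lam i > 0"
proof (rule ccontr)
  assume "\<not> lam i > 0"
  then have neg: "lam i \<le> 0" by simp
  \<comment> \<open>The multiple by \<open>d\<close> of a negative unit vector has an integer
    preimage \<open>u\<close>; along \<open>u\<close> only slack \<open>i\<close> changes, and it
    grows.\<close>
  have "(\<lambda>j. int d * (if j = i then - 1 else 0)) \<in> latt n B"
    by (rule latt_det_mult[OF B(1,2)])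
  from lattE[OF this B(1)] obtain u where u: "u \<in> carrier_vec n"
    and Bu: "\<And>j. j < n \<Longrightarrow> int d * (if j = i then - 1 else 0) = (B *\<^sub>v u) $ j"
    by metis
  have "\<exists>j<n. u $ j \<noteq> 0"
  proof (rule ccontr)
    assume "\<not> ?thesis"
    then have "u = 0\<^sub>v n" using u by (intro eq_vecI) auto
    then have "(B *\<^sub>v u) $ i = 0" using B i by simp
    then show False using Bu[OF i] B(3) by simp
  qed
  then obtain j where j: "j < n" "u $ j \<noteq> 0" by blast
  obtain x where x: "x \<in> S" using S by blast
  then have xc: "x \<in> carrier_vec n" by (simp add: S std_simplex_def)
  have M0: "\<bar>x $ j\<bar> \<le> M" using M[OF x j(1)] .
  \<comment> \<open>This step length exceeds \<open>M + \<bar>x $ j\<bar>\<close>, and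
    \<open>\<bar>u $ j\<bar> \<ge> 1\<close>, so coordinate \<open>j\<close> leaves the bound
    \<open>M\<close>.\<close>
  define s where "s = M + \<bar>x $ j\<bar> + 1"
  have s: "s > 0" using M0 by (simp add: s_def)
  define x' where "x' = x + s \<cdot>\<^sub>v real_vec u"
  have x'c: "x' \<in> carrier_vec n" using xc u by (simp add: x'_def)
  have Bx': "(real_mat B *\<^sub>v x') $ l = (real_mat B *\<^sub>v x) $ l - (if l = i then s * of_nat d else 0)" if l: "l < n" for l
  proof -
    have "(\<Sum>k<n. real_of_int (B $$ (l, k)) * of_int (u $ k)) = of_int ((B *\<^sub>v u) $ l)"
      using B u l by (simp add: mult_mat_vec_index_sum[of B n n] del: index_mult_mat_vec)
    also have "\<dots> = (if l = i then - of_nat d else 0)" unfolding Bu[OF l, symmetric] by simp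
    finally have e: "(\<Sum>k<n. real_of_int (B $$ (l, k)) * of_int (u $ k)) = (if l = i then - of_nat d else 0)" .
    have "(real_mat B *\<^sub>v x') $ l = (\<Sum>k<n. real_of_int (B $$ (l, k)) * (x $ k + s * of_int (u $ k)))"
      using B x'c xc u l by (simp add: mult_mat_vec_index_sum[of _ n n] x'_def del: index_mult_mat_vec)
    also have "\<dots> = (real_mat B *\<^sub>v x) $ l + s * (\<Sum>k<n. real_of_int (B $$ (l, k)) * of_int (u $ k))"
      using B xc l by (simp add: mult_mat_vec_index_sum[of _ n n] distrib_left sum.distrib sum_distrib_left mult_ac del: index_mult_mat_vec)
    finally show ?thesis unfolding e by simp
  qed
  have "(\<Sum>l<n. of_int (lam l) * (of_int (bet l) - (real_mat B *\<^sub>v x') $ l)) =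
     (\<Sum>l<n. of_int (lam l) * (of_int (bet l) - (real_mat B *\<^sub>v x) $ l) + (if l = i then of_int (lam i) * (s * of_nat d) else 0))"
    by (rule sum.cong) (auto simp: Bx' algebra_simps simp del: index_mult_mat_vec)
  also have "\<dots> = (\<Sum>l<n. of_int (lam l) * (of_int (bet l) - (real_mat B *\<^sub>v x) $ l)) + of_int (lam i) * (s * of_nat d)"
    using i by (simp add: sum.distrib)
  also have "\<dots> \<le> (\<Sum>l<n. of_int (lam l) * (of_int (bet l) - (real_mat B *\<^sub>v x) $ l))"
    using neg s by (simp add: mult_nonpos_nonneg)
  also have "\<dots> \<le> of_int N" using x by (simp add: S std_simplex_def)
  finally have "(\<Sum>l<n. of_int (lam l) * (of_int (bet l) - (real_mat B *\<^sub>v x') $ l)) \<le> of_int N" .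
  moreover have "(real_mat B *\<^sub>v x') $ l \<le> of_int (bet l)" if l: "l < n" for l
  proof -
    have "(real_mat B *\<^sub>v x) $ l \<le> of_int (bet l)" using x l by (simp add: S std_simplex_def)
    moreover have "0 \<le> s * real d" using s by simp
    ultimately show ?thesis unfolding Bx'[OF l] using l by (cases "l = i") auto
  qed
  ultimately have "x' \<in> S" using x'c by (simp add: S std_simplex_def)
  from M[OF this j(1)] have "\<bar>x $ j + s * of_int (u $ j)\<bar> \<le> M"
    using j xc u by (simp add: x'_def)
  moreover have "s * 1 \<le> s * \<bar>of_int (u $ j)\<bar>"
    using s j by (intro mult_left_mono) auto
  ultimately show False using s unfolding s_def[symmetric] by (simp add: abs_mult s_def)
qed

lemma polyhedron_iff:
  assumes A: "A \<in> carrier_mat m n" and b: "b \<in> carrier_vec m" and x: "x \<in> carrier_vec n"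
  shows "x \<in> polyhedron n A b \<longleftrightarrow> (\<forall>r<m. (\<Sum>j<n. of_int (A $$ (r, j)) * x $ j) \<le> of_int (b $ r))"
  using assms by (auto simp: polyhedron_def less_eq_vec_def mult_mat_vec_index_sum[of _ m n] simp del: index_mult_mat_vec)

lemma polyhedron_eq_std_simplex:
  assumes A: "A \<in> carrier_mat (n + 1) n" and b: "b \<in> carrier_vec (n + 1)"
    and f: "f ` {..<n} \<union> {k} = {..<n + 1}"
    and d: "d > 0"
    and w: "\<And>j. j < n \<Longrightarrow> (\<Sum>i<n. lam i * A $$ (f i, j)) = - int d * A $$ (k, j)"
  shows "polyhedron n A b = std_simplex n (select_rows n f A) lam (\<lambda>i. b $ f i)
     (int d * b $ k + (\<Sum>i<n. lam i * b $ f i))"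
proof -
  let ?B = "select_rows n f A"
  have "x \<in> polyhedron n A b \<longleftrightarrow> x \<in> std_simplex n ?B lam (\<lambda>i. b $ f i) (int d * b $ k + (\<Sum>i<n. lam i * b $ f i))"
    if x: "x \<in> carrier_vec n" for x
  proof -
    let ?g = "\<lambda>r. \<Sum>j<n. of_int (A $$ (r, j)) * x $ j"
    have B: "(real_mat ?B *\<^sub>v x) $ i = ?g (f i)" if "i < n" for i
      using that x by (simp add: select_rows_def mult_mat_vec_index_sum[of _ n n] del: index_mult_mat_vec)
    have "(\<Sum>i<n. of_int (lam i) * ?g (f i)) = (\<Sum>j<n. of_int (\<Sum>i<n. lam i * A $$ (f i, j)) * x $ j)"
      by (simp add: sum_distrib_left sum_distrib_right mult.assoc) (rule sum.swap)
    also have "\<dots> = - of_nat d * ?g k"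
      unfolding sum_distrib_left by (rule sum.cong) (auto simp: w)
    finally have lam: "(\<Sum>i<n. of_int (lam i) * ?g (f i)) = - of_nat d * ?g k" .
    have "(\<Sum>i<n. of_int (lam i) * (of_int (b $ f i) - (real_mat ?B *\<^sub>v x) $ i)) =
       (\<Sum>i<n. of_int (lam i) * of_int (b $ f i)) - (\<Sum>i<n. of_int (lam i) * ?g (f i))"
      by (simp add: B sum_subtractf right_diff_distrib del: index_mult_mat_vec)
    \<comment> \<open>The terms in \<open>b $ f i\<close> cancel, leaving the inequality of row
      \<open>k\<close> times \<open>d\<close>.\<close>
    then have N: "(\<Sum>i<n. of_int (lam i) * (of_int (b $ f i) - (real_mat ?B *\<^sub>v x) $ i)) \<le>
       of_int (int d * b $ k + (\<Sum>i<n. lam i * b $ f i)) \<longleftrightarrow> of_nat d * ?g k \<le> of_nat d * of_int (b $ k)"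
      unfolding lam by simp
    have "x \<in> polyhedron n A b \<longleftrightarrow> (\<forall>r\<in>f ` {..<n} \<union> {k}. ?g r \<le> of_int (b $ r))"
      unfolding f using polyhedron_iff[OF A b x] by auto
    also have "\<dots> \<longleftrightarrow> (\<forall>i<n. ?g (f i) \<le> of_int (b $ f i)) \<and> of_nat d * ?g k \<le> of_nat d * of_int (b $ k)"
      using d by auto
    also have "\<dots> \<longleftrightarrow> x \<in> std_simplex n ?B lam (\<lambda>i. b $ f i) (int d * b $ k + (\<Sum>i<n. lam i * b $ f i))"
      unfolding std_simplex_def using N B x by (simp del: index_mult_mat_vec)
    finally show ?thesis .
  qed
  then show ?thesis by (auto simp: polyhedron_def std_simplex_def)
qed

lemma modular_simplex_std:
  assumes S: "modular_simplex n d S" and d: "d > 0"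
  obtains B lam bet N where "B \<in> carrier_mat n n" "\<bar>det B\<bar> = int d"
    "\<And>i. i < n \<Longrightarrow> 1 \<le> lam i \<and> lam i \<le> int d"
    "\<And>y. y \<in> latt n B \<Longrightarrow> int d dvd (\<Sum>i<n. lam i * y i)"
    "N \<ge> 0" "S = std_simplex n B lam bet N"
proof -
  obtain A b where A: "A \<in> carrier_mat (n + 1) n" and b: "b \<in> carrier_vec (n + 1)"
    and max: "max_minor A = int d" and SP: "S = polyhedron n A b" and full: "full_dim_simplex n S"
    using S by (auto simp: modular_simplex_def)
  obtain f where f: "inj_on f {..<n}" "f ` {..<n} \<subseteq> {..<n + 1}" and det: "\<bar>det (select_rows n f A)\<bar> = int d"
    using max_minor_attained[OF A] max by auto
  let ?B = "select_rows n f A"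
  have "card ({..<n + 1} - f ` {..<n}) = 1"
    using f by (simp add: card_Diff_subset card_image)
  then obtain k where k: "{..<n + 1} - f ` {..<n} = {k}" by (auto simp: card_1_singleton_iff)
  then have fk: "f ` {..<n} \<union> {k} = {..<n + 1}" using f by blast
  have k': "k < n + 1" "k \<notin> f ` {..<n}" using k by blast+
  obtain w where w: "\<And>i. i < n \<Longrightarrow> \<bar>w i\<bar> \<le> int d"
    "\<And>j. j < n \<Longrightarrow> (\<Sum>i<n. w i * A $$ (f i, j)) = det ?B * A $$ (k, j)"
    using row_combination[OF A f k'] max by metis
  \<comment> \<open>The sign turns the factor \<open>det ?B\<close> of Cramer's rule into
    \<open>- int d\<close>.\<close>
  define lam where "lam i = - sgn (det ?B) * w i" for i
  have lam: "(\<Sum>i<n. lam i * A $$ (f i, j)) = - int d * A $$ (k, j)" if j: "j < n" for j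
  proof -
    have "(\<Sum>i<n. lam i * A $$ (f i, j)) = - sgn (det ?B) * (det ?B * A $$ (k, j))"
      unfolding w(2)[OF j, symmetric] sum_distrib_left lam_def by (simp add: mult.assoc)
    also have "\<dots> = - \<bar>det ?B\<bar> * A $$ (k, j)" by (simp add: abs_sgn)
    finally show ?thesis by (simp add: det)
  qed
  define bet where "bet i = b $ f i" for i
  define N where "N = int d * b $ k + (\<Sum>i<n. lam i * b $ f i)"
  have std: "S = std_simplex n ?B lam bet N"
    unfolding SP bet_def N_def by (rule polyhedron_eq_std_simplex[OF A b fk d lam])
  obtain M where M: "\<And>x j. x \<in> S \<Longrightarrow> j < n \<Longrightarrow> \<bar>x $ j\<bar> \<le> M"
    using full_dim_simplex_bounded(2)[OF full] by blast
  have pos: "lam i > 0" if "i < n" for i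
    using std_simplex_lambda_pos[OF select_rows_carrier det d std full_dim_simplex_bounded(1)[OF full] M that] by blast
  have "lam i \<le> int d" if "i < n" for i
  proof -
    have "\<bar>lam i\<bar> \<le> \<bar>w i\<bar>" by (simp add: lam_def abs_mult sgn_if)
    then show ?thesis using w(1)[OF that] by linarith
  qed
  then have lam_bounds: "1 \<le> lam i \<and> lam i \<le> int d" if "i < n" for i using pos[OF that] that by force
  \<comment> \<open>On a lattice vector \<open>B x\<close> the form \<open>lam\<close> is
    \<open>- d\<close> times row \<open>k\<close> of \<open>A\<close> at \<open>x\<close>; thus
    \<open>lam\<close> induces a character of the quotient group.\<close>
  have dvd: "int d dvd (\<Sum>i<n. lam i * y i)" if y: "y \<in> latt n ?B" for y
  proof -
    obtain x where x: "x \<in> carrier_vec n" "\<And>i. i < n \<Longrightarrow> y i = (?B *\<^sub>v x) $ i"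
      using lattE[OF y select_rows_carrier] by blast
    have "(\<Sum>i<n. lam i * y i) = (\<Sum>i<n. lam i * (\<Sum>j<n. A $$ (f i, j) * x $ j))"
      using x by (intro sum.cong)
        (auto simp: select_rows_def mult_mat_vec_index_sum[of _ n n] simp del: index_mult_mat_vec)
    also have "\<dots> = (\<Sum>j<n. (\<Sum>i<n. lam i * A $$ (f i, j)) * x $ j)"
      by (simp add: sum_distrib_left sum_distrib_right mult.assoc) (rule sum.swap)
    also have "\<dots> = int d * (\<Sum>j<n. - A $$ (k, j) * x $ j)"
      unfolding sum_distrib_left by (rule sum.cong) (auto simp: lam)
    finally show ?thesis by simp
  qed
  \<comment> \<open>The slacks of a point of the simplex are nonnegative, so \<open>N\<close> bounds
    a nonnegative sum.\<close>
  obtain x where x: "x \<in> S" using full_dim_simplex_bounded(1)[OF full] by blast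
  have "0 \<le> (\<Sum>i<n. of_int (lam i) * (of_int (bet i) - (real_mat ?B *\<^sub>v x) $ i))"
    using x pos by (intro sum_nonneg mult_nonneg_nonneg) (auto simp: std std_simplex_def less_imp_le)
  also have "\<dots> \<le> of_int N" using x by (simp add: std std_simplex_def)
  finally have "N \<ge> 0" by simp
  then show ?thesis using that[OF select_rows_carrier det lam_bounds dvd _ std] by blast
qed

text \<open>A nonnegative \<open>u\<close> congruent to \<open>bet\<close> is the slack vector of a
  lattice point; emptiness forces this point to violate the last inequality.\<close>

lemma lattice_free_std_bound:
  assumes B: "B \<in> carrier_mat n n" and S: "lattice_free n (std_simplex n B lam bet N)"
    and u: "bet - u \<in> latt n B" "\<And>i. i < n \<Longrightarrow> u i \<ge> 0"
  shows "N < (\<Sum>i<n. lam i * u i)"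
proof (rule ccontr)
  assume N: "\<not> N < (\<Sum>i<n. lam i * u i)"
  obtain x where x: "x \<in> carrier_vec n" "\<And>i. i < n \<Longrightarrow> (bet - u) i = (B *\<^sub>v x) $ i"
    using lattE[OF u(1) B] by blast
  have Bx: "(real_mat B *\<^sub>v real_vec x) $ i = of_int (bet i) - of_int (u i)" if i: "i < n" for i
  proof -
    have "(real_mat B *\<^sub>v real_vec x) $ i = of_int ((B *\<^sub>v x) $ i)"
      using B x(1) i by (simp add: mult_mat_vec_index_sum[of _ n n] del: index_mult_mat_vec)
    then show ?thesis using x(2)[OF i] by (metis minus_apply of_int_diff)
  qed
  have eq: "(\<Sum>i<n. of_int (lam i) * (of_int (bet i) - (real_mat B *\<^sub>v real_vec x) $ i)) = real_of_int (\<Sum>i<n. lam i * u i)"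
    unfolding of_int_sum by (rule sum.cong) (auto simp: Bx simp del: index_mult_mat_vec)
  have "real_of_int (\<Sum>i<n. lam i * u i) \<le> of_int N" using N by (simp only: of_int_le_iff not_less)
  then have "real_vec x \<in> std_simplex n B lam bet N"
    unfolding std_simplex_def mem_Collect_eq eq using x(1) u(2) by (simp add: Bx del: index_mult_mat_vec)
  then show False using S x(1) by (auto simp: lattice_free_def)
qed

section \<open>Presentations of the quotient group and codes of simplices\<close>

text \<open>The homomorphism sending the \<open>i\<close>th unit vector to \<open>v i\<close>;
  coordinates of \<open>z\<close> from \<open>m\<close> on are ignored.\<close>

definition icomb :: "nat \<Rightarrow> (nat \<Rightarrow> int) \<Rightarrow> (nat \<Rightarrow> nat \<Rightarrow> int) \<Rightarrow> nat \<Rightarrow> int" where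
  "icomb m z v = (\<lambda>l. \<Sum>i<m. z i * v i l)"

lemma icomb_diff_left: "icomb m (y - z) v = icomb m y v - icomb m z v"
  by (auto simp: icomb_def fun_eq_iff left_diff_distrib sum_subtractf)

lemma icomb_zero: "icomb m 0 v = 0"
  by (auto simp: icomb_def fun_eq_iff)

lemma icomb_diff_right: "icomb m z v - icomb m z v' = icomb m z (\<lambda>i. v i - v' i)"
  by (auto simp: icomb_def fun_eq_iff right_diff_distrib sum_subtractf)

lemma icomb_icomb: "icomb m z (\<lambda>i. icomb p (v i) g) = icomb p (icomb m z v) g"
  by (auto simp: icomb_def fun_eq_iff sum_distrib_left sum_distrib_right mult.assoc intro: sum.swap)

lemma icomb_as_sum: "icomb m z v = (\<Sum>i<m. (\<lambda>l. z i * v i l))"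
  by (induction m) (auto simp: icomb_def fun_eq_iff)

lemma subgrp_icomb:
  assumes "subgrp H" "\<And>i. i < m \<Longrightarrow> v i \<in> H"
  shows "icomb m z v \<in> H"
  unfolding icomb_as_sum by (rule subgrp_sum[OF assms(1)]) (use assms in \<open>auto intro: subgrp_mult\<close>)

lemma icomb_scaled: "icomb m (\<lambda>i. k * z i) v = icomb m z (\<lambda>i l. k * v i l)"
  by (auto simp: icomb_def fun_eq_iff mult_ac)

lemma icomb_permute:
  assumes s: "s permutes {..<n}"
  shows "icomb n (y \<circ> inv_into UNIV s) v = icomb n y (v \<circ> s)"
proof
  fix l
  have "icomb n (y \<circ> inv_into UNIV s) v l = (\<Sum>i<n. (y \<circ> inv_into UNIV s) (s i) * v (s i) l)"
    unfolding icomb_def using sum.permute[OF s, of "\<lambda>i. (y \<circ> inv_into UNIV s) i * v i l"] by (simp add: o_def)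
  then show "icomb n (y \<circ> inv_into UNIV s) v l = icomb n y (v \<circ> s) l"
    using permutes_inverses[OF s] by (simp add: icomb_def)
qed

text \<open>Padding with the default \<open>a\<close> gives generating families of one fixed length,
  whatever the size of \<open>J\<close>.\<close>

lemma bounded_enumeration:
  assumes "finite J" "card J \<le> p" "J \<subseteq> A" "a \<in> A"
  obtains g where "J \<subseteq> g ` {..<p}" "\<And>l::nat. g l \<in> A"
proof -
  obtain h where h: "bij_betw h {0..<card J} J" using ex_bij_betw_nat_finite[OF assms(1)] by blast
  define g where "g l = (if l < card J then h l else a)" for l
  have hJ: "h ` {0..<card J} = J" using h by (simp add: bij_betw_def)
  have "J \<subseteq> g ` {..<p}"
  proof
    fix x assume "x \<in> J"
    then obtain l where "l < card J" "x = h l" using hJ by force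
    then show "x \<in> g ` {..<p}" using assms(2) by (intro image_eqI[of _ _ l]) (auto simp: g_def)
  qed
  moreover have "g l \<in> A" for l using hJ assms(3,4) by (auto simp: g_def)
  ultimately show ?thesis using that by blast
qed

text \<open>Fixing one labelling per subgroup lets labels be compared between simplices that share
  \<open>K\<close>.\<close>

definition label :: "nat \<Rightarrow> (nat \<Rightarrow> int) set \<Rightarrow> (nat \<Rightarrow> int) \<Rightarrow> nat" where
  "label d K = (SOME lab. exact_labelling K d lab)"

text \<open>The second condition makes \<open>K\<close> the preimage of a subgroup of the finite
  group \<open>(\<int>/d)^p\<close>; the third bounds the index of \<open>K\<close> by
  \<open>d\<close>.\<close>

definition index_subgroups :: "nat \<Rightarrow> nat \<Rightarrow> (nat \<Rightarrow> int) set set" where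
  "index_subgroups d p = {K. subgrp K \<and> {z. \<forall>l<p. int d dvd z l} \<subseteq> K \<and> (\<exists>lab. exact_labelling K d lab)}"

lemma label:
  assumes "K \<in> index_subgroups d p"
  shows "label d K z < d" "label d K y = label d K z \<longleftrightarrow> y - z \<in> K"
proof -
  have "\<exists>lab. exact_labelling K d lab" using assms by (simp add: index_subgroups_def)
  then have "exact_labelling K d (label d K)" unfolding label_def by (rule someI_ex)
  then show "label d K z < d" "label d K y = label d K z \<longleftrightarrow> y - z \<in> K"
    by (auto simp: exact_labelling_def)
qed

definition weight :: "int list \<Rightarrow> (nat \<Rightarrow> int) \<Rightarrow> int" where
  "weight mu z = (\<Sum>l<length mu. mu ! l * z l)"

lemma weight_diff: "weight mu (y - z) = weight mu y - weight mu z"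
  by (simp add: weight_def right_diff_distrib sum_subtractf)

text \<open>A code \<open>(K, mu, b, N, cs)\<close> presents the group \<open>G\<close> of order \<open>d\<close> formed by the integer vectors modulo
  \<open>latt n B\<close> as the integer vectors of length \<open>p\<close> modulo \<open>K\<close>. The vector \<open>v i\<close> represents the class
  of the \<open>i\<close>th unit vector and determines \<open>lam i\<close>, the residue in \<open>{1..d}\<close> of a character of \<open>G\<close>
  given by \<open>mu\<close>. Up to reordering the rows only the number \<open>cs ! c\<close> of those \<open>i\<close> matters for which
  \<open>v i\<close> lies in the class with label \<open>c\<close>, and up to translation only the class \<open>b\<close> of \<open>bet\<close>.\<close>

type_synonym code = "(nat \<Rightarrow> int) set \<times> int list \<times> nat \<times> int \<times> nat list"

definition presents :: "nat \<Rightarrow> nat \<Rightarrow> int mat \<Rightarrow> (nat \<Rightarrow> int) \<Rightarrow> (nat \<Rightarrow> int) \<Rightarrow> (nat \<Rightarrow> nat \<Rightarrow> int) \<Rightarrow> code \<Rightarrow> bool" where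
  "presents n d B lam bet v = (\<lambda>(K, mu, b, N, cs).
     (\<forall>y. y \<in> latt n B \<longleftrightarrow> icomb n y v \<in> K) \<and>
     (\<forall>i<n. int d dvd lam i - weight mu (v i)) \<and> (\<forall>z\<in>K. int d dvd weight mu z) \<and>
     b = label d K (icomb n bet v) \<and> cs = map (\<lambda>l. card {i. i < n \<and> label d K (v i) = l}) [0..<d])"

definition has_code :: "nat \<Rightarrow> nat \<Rightarrow> real vec set \<Rightarrow> code \<Rightarrow> bool" where
  "has_code n d S c \<longleftrightarrow> (\<exists>B lam bet v.
     B \<in> carrier_mat n n \<and> \<bar>det B\<bar> = int d \<and> (\<forall>i<n. 1 \<le> lam i \<and> lam i \<le> int d) \<and>
     S = std_simplex n B lam bet (fst (snd (snd (snd c)))) \<and> presents n d B lam bet v c)"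

text \<open>Only the weak compositions \<open>cs\<close> of \<open>n\<close> into \<open>d\<close>
  parts depend on \<open>n\<close>; the numbers of choices for the other components are bounded by
  powers of \<open>d\<close>.\<close>

definition codes :: "nat \<Rightarrow> nat \<Rightarrow> nat \<Rightarrow> code set" where
  "codes n d p = index_subgroups d p \<times> {mu. set mu \<subseteq> {1..int d} \<and> length mu = p} \<times> {..<d} \<times>
     {0..<int (d ^ 3)} \<times> {cs. length cs = d \<and> sum_list cs = n}"

text \<open>Equal class counts yield a permutation \<open>s\<close> of the rows matching the classes
  of \<open>v\<close> and \<open>v'\<close>. After it, the lattices, the forms and the classes of
  the right-hand sides coincide.\<close>

lemma has_code_equivalent:
  assumes c: "c \<in> codes n d p" and S: "has_code n d S c" and S': "has_code n d S' c" and d: "d > 0"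
  shows "(S, S') \<in> integer_equivalence n"
proof -
  obtain K mu b N cs where c_eq: "c = (K, mu, b, N, cs)" by (metis prod_cases5)
  then have K: "K \<in> index_subgroups d p" using c by (auto simp: codes_def)
  then have sK: "subgrp K" by (simp add: index_subgroups_def)
  obtain B lam bet v where B: "B \<in> carrier_mat n n" "\<bar>det B\<bar> = int d"
    and lam_all: "\<forall>i<n. 1 \<le> lam i \<and> lam i \<le> int d"
    and S_eq: "S = std_simplex n B lam bet N"
    and pres: "presents n d B lam bet v c"
    using S unfolding has_code_def c_eq fst_conv snd_conv by blast
  note lam = lam_all[rule_format]
  have latt: "y \<in> latt n B \<longleftrightarrow> icomb n y v \<in> K" for y
    using pres unfolding presents_def c_eq prod.case by blast
  have wt: "int d dvd lam i - weight mu (v i)" if "i < n" for i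
    using pres that unfolding presents_def c_eq prod.case by blast
  have b: "b = label d K (icomb n bet v)"
    and cs: "cs = map (\<lambda>l. card {i. i < n \<and> label d K (v i) = l}) [0..<d]"
    using pres unfolding presents_def c_eq prod.case by blast+
  obtain B' lam' bet' v' where B': "B' \<in> carrier_mat n n" "\<bar>det B'\<bar> = int d"
    and lam'_all: "\<forall>i<n. 1 \<le> lam' i \<and> lam' i \<le> int d"
    and S'_eq: "S' = std_simplex n B' lam' bet' N"
    and pres': "presents n d B' lam' bet' v' c"
    using S' unfolding has_code_def c_eq fst_conv snd_conv by blast
  note lam' = lam'_all[rule_format]
  have latt': "y \<in> latt n B' \<longleftrightarrow> icomb n y v' \<in> K" for y
    using pres' unfolding presents_def c_eq prod.case by blast
  have wt': "int d dvd lam' i - weight mu (v' i)" if "i < n" for i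
    using pres' that unfolding presents_def c_eq prod.case by blast
  have b': "b = label d K (icomb n bet' v')"
    and cs': "cs = map (\<lambda>l. card {i. i < n \<and> label d K (v' i) = l}) [0..<d]"
    using pres' unfolding presents_def c_eq prod.case by blast+
  have wK: "int d dvd weight mu z" if "z \<in> K" for z
    using pres that unfolding presents_def c_eq prod.case by blast
  \<comment> \<open>A multiset is determined by its multiplicities: \<open>cs\<close> records those
    of the labels below \<open>d\<close>, and no other label occurs.\<close>
  have "image_mset (\<lambda>i. label d K (v i)) (mset_set {..<n}) = image_mset (\<lambda>i. label d K (v' i)) (mset_set {..<n})"
  proof (rule multiset_eqI)
    fix l
    have "card {i. i < n \<and> label d K (v i) = l} = card {i. i < n \<and> label d K (v' i) = l}"
    proof (cases "l < d")
      case True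
      then have "cs ! l = card {i. i < n \<and> label d K (v i) = l}" "cs ! l = card {i. i < n \<and> label d K (v' i) = l}"
        using arg_cong[OF cs, of "\<lambda>xs. xs ! l"] arg_cong[OF cs', of "\<lambda>xs. xs ! l"] by simp_all
      then show ?thesis by simp
    next
      case False
      then have "label d K z \<noteq> l" for z using label(1)[OF K, of z] by auto
      then show ?thesis by simp
    qed
    then show "count (image_mset (\<lambda>i. label d K (v i)) (mset_set {..<n})) l =
        count (image_mset (\<lambda>i. label d K (v' i)) (mset_set {..<n})) l"
      by (simp add: count_image_mset_eq_card_vimage)
  qed
  then obtain s where s: "s permutes {..<n}" and ls: "\<forall>i\<in>{..<n}. label d K (v i) = label d K (v' (s i))"
    by (rule image_mset_eq_implies_permutes[rotated]) auto
  have vK: "v i - v' (s i) \<in> K" if "i < n" for i using ls that label(2)[OF K] by auto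
  have perm: "icomb n y v \<in> K \<longleftrightarrow> icomb n y (v' \<circ> s) \<in> K" for y
    by (rule subgrp_mem_cong[OF sK]) (use vK in \<open>auto simp: icomb_diff_right intro: subgrp_icomb[OF sK]\<close>)
  let ?B = "select_rows n s B'"
  have latt_eq: "latt n ?B = latt n B"
    using latt_permute_rows[OF B'(1) s] latt latt' perm icomb_permute[OF s] by auto
  \<comment> \<open>By \<open>latt\<close> this says that two \<open>icomb\<close> values differ by
    an element of \<open>K\<close>: permuting both arguments preserves
    \<open>icomb n bet' v'\<close>, whose label \<open>b\<close> is shared.\<close>
  have "(bet' \<circ> s) - bet \<in> latt n B"
  proof -
    have "(bet' \<circ> s) \<circ> inv_into UNIV s = bet'" using permutes_inverses[OF s] by (auto simp: fun_eq_iff)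
    then have "icomb n bet' v' = icomb n (bet' \<circ> s) (v' \<circ> s)" using icomb_permute[OF s, of "bet' \<circ> s" v'] by simp
    moreover have "icomb n bet v - icomb n bet' v' \<in> K" using b b' label(2)[OF K] by metis
    moreover have "icomb n (bet' \<circ> s) v - icomb n (bet' \<circ> s) (v' \<circ> s) \<in> K"
      unfolding icomb_diff_right by (rule subgrp_icomb[OF sK]) (use vK in auto)
    ultimately have "(icomb n (bet' \<circ> s) v - icomb n (bet' \<circ> s) (v' \<circ> s)) - (icomb n bet v - icomb n (bet' \<circ> s) (v' \<circ> s)) \<in> K"
      using subgrp_diff[OF sK] by metis
    then show ?thesis unfolding latt icomb_diff_left by simp
  qed
  moreover have "lam i = (lam' \<circ> s) i" if i: "i < n" for i
  proof -
    have si: "s i < n" using permutes_in_image[OF s, of i] i by simp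
    \<comment> \<open>Both coefficients have the same residue modulo \<open>d\<close>, which
      determines a value in \<open>{1..d}\<close>.\<close>
    have "int d dvd (lam i - weight mu (v i)) - (lam' (s i) - weight mu (v' (s i))) + weight mu (v i - v' (s i))"
      by (rule dvd_add[OF dvd_diff[OF wt[OF i] wt'[OF si]] wK[OF vK[OF i]]])
    then have dvd: "int d dvd lam i - lam' (s i)" by (simp add: weight_diff)
    have "\<bar>lam i - lam' (s i)\<bar> < int d" using lam[OF i] lam'[OF si] by auto
    then have "lam i - lam' (s i) = 0" using dvd by (metis abs_of_nat dvd_imp_le_int not_le)
    then show ?thesis by simp
  qed
  ultimately show ?thesis
    unfolding S_eq S'_eq std_simplex_permute_rows[OF B'(1) s, of lam' bet' N, symmetric]
    by (intro std_simplex_equivalent) (use B B' abs_det_permute_rows[OF B'(1) s] latt_eq d select_rows_carrier in auto)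
qed

definition delta :: "nat \<Rightarrow> nat \<Rightarrow> int" where
  "delta j = (\<lambda>i. if i = j then 1 else 0)"

text \<open>\<open>icomb n y delta\<close> truncates \<open>y\<close> after \<open>n\<close>
  coordinates, which membership in \<open>latt n B\<close> does not see.\<close>

lemma minus_icomb_delta_in_latt:
  assumes "B \<in> carrier_mat n n"
  shows "y - icomb n y delta \<in> latt n B"
proof (rule lattI[OF assms, of "0\<^sub>v n"])
  fix i assume "i < n"
  then show "(y - icomb n y delta) i = (B *\<^sub>v 0\<^sub>v n) $ i"
    using assms by (simp add: icomb_def delta_def if_distrib cong: if_cong)
qed simp

lemma sum_list_fibre_cards:
  assumes "\<And>i. i < n \<Longrightarrow> f i < d"
  shows "sum_list (map (\<lambda>c. card {i. i < n \<and> f i = c}) [0..<d]) = (n::nat)"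
proof -
  have "sum_list (map (\<lambda>c. card {i. i < n \<and> f i = c}) [0..<d]) = (\<Sum>c<d. card {i. i < n \<and> f i = c})"
    by (simp add: interv_sum_list_conv_sum_set_nat lessThan_atLeast0)
  also have "\<dots> = (\<Sum>c<d. \<Sum>i | i \<in> {..<n} \<and> f i = c. 1)" by simp
  also have "\<dots> = (\<Sum>i<n. 1)" by (rule sum.group) (use assms in auto)
  finally show ?thesis by simp
qed

text \<open>At most \<open>p\<close> unit vectors generate the group. Expressing all unit vectors
  through them gives \<open>v\<close>, the relations among them form \<open>K\<close>, and emptiness
  bounds \<open>N\<close>.\<close>

lemma has_code_exists:
  assumes S: "S \<in> empty_modular_simplices n d" and n: "1 \<le> n" and d: "1 \<le> d" and p: "2 ^ p \<le> d" "d < 2 ^ (p + 1)"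
  shows "\<exists>c\<in>codes n d p. has_code n d S c"
proof -
  have free: "lattice_free n S" and mod: "modular_simplex n d S" and d0: "d > 0"
    using S d by (auto simp: empty_modular_simplices_def)
  obtain B lam bet N
    where B: "B \<in> carrier_mat n n" "\<bar>det B\<bar> = int d"
    and lam: "\<And>i. i < n \<Longrightarrow> 1 \<le> lam i \<and> lam i \<le> int d"
    and dvd: "\<And>y. y \<in> latt n B \<Longrightarrow> int d dvd (\<Sum>i<n. lam i * y i)"
    and N: "N \<ge> 0" and S_eq: "S = std_simplex n B lam bet N"
    by (rule modular_simplex_std[OF mod d0]) (rule that; blast)
  define L where "L = latt n B"
  have L: "subgrp L" unfolding L_def by (rule subgrp_latt[OF B(1)])
  have dL: "(\<lambda>i. int d * y i) \<in> L" for y unfolding L_def by (rule latt_det_mult[OF B])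
  obtain lab where lab: "labelling L d lab" using latt_labelling[OF B] d unfolding L_def by auto
  obtain J where J: "J \<subseteq> delta ` {..<n}" "finite J" "2 ^ card J \<le> d" "delta ` {..<n} \<subseteq> subgrp hull (J \<union> L)"
    using small_generating_set[OF L lab] by blast
  have "(2::nat) ^ card J < 2 ^ (p + 1)" using J(3) p(2) by linarith
  then have "card J < p + 1" by (rule power_less_imp_less_exp[rotated]) simp
  then have "card J \<le> p" by simp
  moreover have "delta 0 \<in> delta ` {..<n}" using n by auto
  ultimately obtain g where g: "J \<subseteq> g ` {..<p}" "\<And>l. g l \<in> delta ` {..<n}"
    using bounded_enumeration[OF J(2) _ J(1)] by metis
  from g(2) have "\<exists>j. j < n \<and> g l = delta j" for l by blast
  then obtain js where js: "\<And>l. js l < n" "\<And>l. g l = delta (js l)" by metis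
  \<comment> \<open>Vectors expressible through \<open>g\<close> modulo \<open>L\<close> form a
    subgroup; it contains \<open>J\<close> and \<open>L\<close>, hence all that they
    generate.\<close>
  have "subgrp {y. \<exists>w. y - icomb p w g \<in> L}"
    unfolding subgrp_def
  proof (intro conjI ballI)
    show "0 \<in> {y. \<exists>w. y - icomb p w g \<in> L}"
      by (intro CollectI exI[of _ 0]) (simp add: icomb_zero subgrp_zero[OF L])
    fix x y assume "x \<in> {y. \<exists>w. y - icomb p w g \<in> L}" "y \<in> {y. \<exists>w. y - icomb p w g \<in> L}"
    then obtain w w' where "x - icomb p w g \<in> L" "y - icomb p w' g \<in> L" by blast
    from subgrp_diff[OF L this] have "(x - y) - icomb p (w - w') g \<in> L"
      by (simp add: icomb_diff_left algebra_simps)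
    then show "x - y \<in> {y. \<exists>w. y - icomb p w g \<in> L}" by blast
  qed
  moreover have "J \<union> L \<subseteq> {y. \<exists>w. y - icomb p w g \<in> L}"
  proof
    fix y assume "y \<in> J \<union> L"
    then consider "y \<in> L" | l where "l < p" "y = g l" using g(1) by blast
    then show "y \<in> {y. \<exists>w. y - icomb p w g \<in> L}"
    proof cases
      case 1
      then show ?thesis by (intro CollectI exI[of _ 0]) (simp add: icomb_zero)
    next
      case 2
      have "icomb p (delta l) g = g l" using 2 by (auto simp: icomb_def delta_def fun_eq_iff if_distrib[of "\<lambda>x. x * _"] cong: if_cong)
      then have "y - icomb p (delta l) g \<in> L" using 2 subgrp_zero[OF L] by simp
      then show ?thesis by blast
    qed
  qed
  ultimately have "delta ` {..<n} \<subseteq> {y. \<exists>w. y - icomb p w g \<in> L}"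
    using order_trans[OF J(4) hull_minimal] by blast
  then have "\<exists>w. i < n \<longrightarrow> delta i - icomb p w g \<in> L" for i by blast
  then obtain v where v: "\<And>i. i < n \<Longrightarrow> delta i - icomb p (v i) g \<in> L" by metis
  \<comment> \<open>The relations among the generators: the kernel of the map from coefficient
    vectors to the quotient by \<open>L\<close>.\<close>
  define K where "K = {z. icomb p z g \<in> L}"
  have rep: "y - icomb p (icomb n y v) g \<in> L" for y
  proof -
    have "icomb n y delta - icomb n y (\<lambda>i. icomb p (v i) g) \<in> L"
      unfolding icomb_diff_right by (rule subgrp_icomb[OF L v])
    then have "(y - icomb n y delta) + (icomb n y delta - icomb p (icomb n y v) g) \<in> L"
      unfolding icomb_icomb using minus_icomb_delta_in_latt[OF B(1)] subgrp_add[OF L] L_def by blast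
    then show ?thesis by simp
  qed
  have latt: "y \<in> latt n B \<longleftrightarrow> icomb n y v \<in> K" for y
    using subgrp_mem_cong[OF L rep] by (simp add: K_def L_def)
  have sK: "subgrp K"
    using subgrp_zero[OF L] subgrp_diff[OF L]
    by (simp add: subgrp_def K_def icomb_diff_left icomb_zero)
  have MK: "z \<in> K" if "\<And>l. l < p \<Longrightarrow> int d dvd z l" for z
  proof -
    have "icomb p z g = icomb p (\<lambda>l. int d * (z l div int d)) g"
      using that by (auto simp: icomb_def fun_eq_iff)
    also have "\<dots> \<in> L" unfolding icomb_scaled by (rule subgrp_icomb[OF L dL])
    finally show ?thesis by (simp add: K_def)
  qed
  have "labelling K d (\<lambda>z. lab (icomb p z g))"
    using lab by (auto simp: labelling_def K_def icomb_diff_left)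
  then have K: "K \<in> index_subgroups d p"
    using exact_labelling_exists[OF sK] sK MK by (auto simp: index_subgroups_def)
  define phi where "phi y = (\<Sum>i<n. lam i * y i)" for y :: "nat \<Rightarrow> int"
  have phi_dvd: "int d dvd phi y" if "y \<in> L" for y
    unfolding phi_def using dvd that L_def by blast
  have phi_diff: "phi (x - y) = phi x - phi y" for x y
    by (simp add: phi_def right_diff_distrib sum_subtractf)
  \<comment> \<open>As the generators are unit vectors, the form takes at \<open>g l\<close> the
    value \<open>lam (js l)\<close>, which lies in \<open>{1..d}\<close>.\<close>
  define mu where "mu = map (\<lambda>l. lam (js l)) [0..<p]"
  have phi_delta: "phi (delta j) = lam j" if "j < n" for j
    using that by (simp add: phi_def delta_def if_distrib cong: if_cong)
  have phi_icomb: "phi (icomb p z g) = weight mu z" for z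
  proof -
    have "phi (icomb p z g) = (\<Sum>l<p. phi (g l) * z l)"
      unfolding phi_def icomb_def sum_distrib_left sum_distrib_right
      by (subst sum.swap) (simp add: mult_ac)
    then show ?thesis using js phi_delta by (simp add: weight_def mu_def)
  qed
  have wt: "int d dvd lam i - weight mu (v i)" if "i < n" for i
    using phi_dvd[OF v[OF that]] unfolding phi_diff phi_icomb phi_delta[OF that] .
  have wK: "int d dvd weight mu z" if "z \<in> K" for z
    using phi_dvd[of "icomb p z g"] that by (simp add: K_def phi_icomb)
  have "N < int (d ^ 3)"
  proof -
    \<comment> \<open>Reducing the coordinates of \<open>bet\<close> modulo \<open>d\<close> gives a
      congruent vector \<open>u\<close>, nonnegative because the generators are unit vectors, of
      weight at most \<open>p * (d * d) \<le> d ^ 3\<close>.\<close>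
    define W where "W = (\<lambda>l. icomb n bet v l mod int d)"
    define u where "u = icomb p W g"
    have "icomb n bet v - W \<in> K" by (rule MK) (simp add: W_def minus_mod_eq_mult_div)
    then have "icomb p (icomb n bet v) g - u \<in> L" by (simp add: K_def icomb_diff_left u_def)
    from subgrp_add[OF L rep[of bet] this] have "bet - u \<in> latt n B" by (simp add: L_def)
    moreover have "u i \<ge> 0" for i
      using d by (auto simp: u_def icomb_def W_def js delta_def intro!: sum_nonneg)
    ultimately have "N < phi u"
      unfolding phi_def using lattice_free_std_bound[OF B(1)] free S_eq by blast
    also have "phi u = (\<Sum>l<p. lam (js l) * W l)"
      unfolding u_def phi_icomb weight_def by (simp add: mu_def)
    also have "\<dots> \<le> (\<Sum>l<p. int d * int d)"
      using d lam[OF js(1)] by (intro sum_mono mult_mono) (auto simp: W_def less_imp_le)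
    also have "\<dots> = int (p * (d * d))" by simp
    also have "\<dots> \<le> int (d ^ 3)"
    proof -
      have "p \<le> d" using less_exp[of p] p(1) by linarith
      then show ?thesis unfolding of_nat_le_iff by (simp add: power3_eq_cube)
    qed
    finally show ?thesis .
  qed
  moreover have "set mu \<subseteq> {1..int d}" "length mu = p" using lam js by (auto simp: mu_def)
  ultimately have "(K, mu, label d K (icomb n bet v), N, map (\<lambda>l. card {i. i < n \<and> label d K (v i) = l}) [0..<d]) \<in> codes n d p"
    using K N label(1)[OF K] by (simp add: codes_def sum_list_fibre_cards)
  moreover have "has_code n d S (K, mu, label d K (icomb n bet v), N, map (\<lambda>l. card {i. i < n \<and> label d K (v i) = l}) [0..<d])"
    unfolding has_code_def fst_conv snd_conv presents_def prod.case using B lam S_eq latt wt wK by blast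
  ultimately show ?thesis by blast
qed

section \<open>Counting codes and classes\<close>

text \<open>Choosing one element for each code reaches every class: a member of the class is
  equivalent to the element chosen for its code.\<close>

lemma card_quotient_le:
  assumes r: "equiv A r" and C: "finite C" and F: "\<And>x. x \<in> X \<Longrightarrow> F x \<in> C"
    and eq: "\<And>x y. x \<in> X \<Longrightarrow> y \<in> X \<Longrightarrow> F x = F y \<Longrightarrow> (x, y) \<in> r"
  shows "finite (X // r)" "card (X // r) \<le> card C"
proof -
  define h where "h c = r `` {SOME x. x \<in> X \<and> F x = c}" for c
  have "X // r \<subseteq> h ` C"
  proof
    fix Q assume "Q \<in> X // r"
    then obtain x where x: "Q = r `` {x}" "x \<in> X" by (rule quotientE)
    define y where "y = (SOME y. y \<in> X \<and> F y = F x)"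
    have "y \<in> X \<and> F y = F x" unfolding y_def by (rule someI[of _ x]) (simp add: x)
    then have "(y, x) \<in> r" using eq x(2) by blast
    then have "r `` {y} = Q" unfolding x(1) by (rule equiv_class_eq[OF r])
    then have "Q = h (F x)" by (simp add: h_def y_def)
    then show "Q \<in> h ` C" using F[OF x(2)] by (rule image_eqI)
  qed
  then show "finite (X // r)" "card (X // r) \<le> card C"
    using C by (auto intro: finite_subset surj_card_le)
qed

text \<open>Modulo \<open>M\<close> there are at most \<open>d ^ p \<le> 2 ^ (p * (p + 1))\<close>
  classes, so \<open>K\<close> is generated over \<open>M\<close> by at most
  \<open>p * (p + 1)\<close> vectors with entries in \<open>{0..<d}\<close>; lists of such vectors
  are counted.\<close>

lemma card_index_subgroups:
  assumes d: "1 \<le> d" "d < 2 ^ (p + 1)"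
  shows "finite (index_subgroups d p)" "card (index_subgroups d p) \<le> (d ^ p) ^ (p * (p + 1))"
proof -
  define M where "M = {z :: nat \<Rightarrow> int. \<forall>l<p. int d dvd z l}"
  define D where "D = {xs. set xs \<subseteq> {..<d} \<and> length xs = p}"
  define f where "f xs = (\<lambda>l. if l < p then int (xs ! l) else 0)" for xs
  define R where "R = f ` D"
  define red where "red z = (\<lambda>l. if l < p then z l mod int d else 0)" for z
  let ?q = "p * (p + 1)"
  have M: "subgrp M" by (auto simp: subgrp_def M_def)
  have D: "finite D" "card D = d ^ p"
    by (simp_all add: D_def finite_lists_length_eq card_lists_length_eq)
  then have R: "finite R" "card R \<le> d ^ p"
    unfolding R_def using card_image_le[OF D(1), of f] by auto
  have red_R: "red z \<in> R" for z
  proof -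
    have "red z = f (map (\<lambda>l. nat (z l mod int d)) [0..<p])"
      using d(1) by (auto simp: red_def f_def fun_eq_iff)
    moreover have "map (\<lambda>l. nat (z l mod int d)) [0..<p] \<in> D"
      using d(1) by (auto simp: D_def nat_less_iff)
    ultimately show ?thesis by (simp add: R_def)
  qed
  have red_M: "z - red z \<in> M" for z
    by (simp add: M_def red_def minus_mod_eq_mult_div)
  \<comment> \<open>\<open>h\<close> numbers the reduced vectors, turning reduction modulo
    \<open>d\<close> into a labelling for \<open>M\<close>.\<close>
  obtain h m where h: "h ` R = {i::nat. i < m}" "inj_on h R"
    using finite_imp_inj_to_nat_seg[OF R(1)] by blast
  have "m = card R" using card_image[OF h(2)] h(1) by simp
  have "labelling M (d ^ p) (\<lambda>z. h (red z))"
    unfolding labelling_def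
  proof (intro conjI allI impI)
    fix x
    have "h (red x) < m" using h(1) red_R by blast
    then show "h (red x) < d ^ p" using \<open>m = card R\<close> R(2) by simp
  next
    fix x y assume "h (red x) = h (red y)"
    then have "red x = red y" using h(2) red_R by (simp add: inj_on_eq_iff)
    then show "x - y \<in> M" using subgrp_diff[OF M red_M[of x] red_M[of y]] by simp
  qed
  note lab = this
  have "\<exists>xs. set xs \<subseteq> R \<and> length xs = ?q \<and> K = subgrp hull (set xs \<union> M)"
    if K: "K \<in> index_subgroups d p" for K
  proof -
    have sK: "subgrp K" and MK: "M \<subseteq> K" using K by (auto simp: index_subgroups_def M_def)
    obtain J where J: "J \<subseteq> K \<inter> R" "finite J" "2 ^ card J \<le> d ^ p" "K \<inter> R \<subseteq> subgrp hull (J \<union> M)"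
      using small_generating_set[OF M lab] by blast
    have "d ^ p \<le> (2 ^ (p + 1)) ^ p" using d by (intro power_mono) auto
    then have "(2::nat) ^ card J \<le> 2 ^ ?q" using J(3) by (simp only: power_mult[symmetric] mult.commute)
    then have "card J \<le> ?q" by (rule power_le_imp_le_exp[rotated]) simp
    then obtain g where g: "J \<subseteq> g ` {..<?q}" "\<And>l. g l \<in> insert 0 J"
      using bounded_enumeration[OF J(2), of ?q "insert 0 J" 0] by blast
    define xs where "xs = map g [0..<?q]"
    have set_xs: "set xs = g ` {..<?q}" by (auto simp: xs_def)
    \<comment> \<open>Padding by 0 is harmless: 0 is a reduced vector and lies in
      \<open>M\<close>.\<close>
    have "red 0 = 0" by (auto simp: red_def fun_eq_iff)
    then have "0 \<in> R" using red_R[of 0] by simp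
    then have "insert 0 J \<subseteq> R" using J(1) by simp
    then have "g l \<in> R" for l using g(2) by (rule subsetD)
    then have "set xs \<subseteq> R" unfolding set_xs by blast
    moreover have "set xs \<union> M = J \<union> M"
    proof
      have "insert 0 J \<subseteq> J \<union> M" using subgrp_zero[OF M] by simp
      then have "g l \<in> J \<union> M" for l using g(2) by (rule subsetD)
      then show "set xs \<union> M \<subseteq> J \<union> M" unfolding set_xs by blast
      show "J \<union> M \<subseteq> set xs \<union> M" using g(1) unfolding set_xs by blast
    qed
    moreover have "K = subgrp hull (J \<union> M)"
    proof
      show "subgrp hull (J \<union> M) \<subseteq> K" by (rule hull_minimal) (use J(1) MK sK in auto)
      show "K \<subseteq> subgrp hull (J \<union> M)"
      proof
        fix z assume z: "z \<in> K"
        have "z - (z - red z) \<in> K" using z red_M MK subgrp_diff[OF sK] by blast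
        then have "red z \<in> subgrp hull (J \<union> M)" using J(4) red_R by auto
        moreover have "z - red z \<in> subgrp hull (J \<union> M)"
          using red_M hull_subset[of "J \<union> M" subgrp] by blast
        ultimately have "red z + (z - red z) \<in> subgrp hull (J \<union> M)" by (rule subgrp_add[OF subgrp_hull])
        then show "z \<in> subgrp hull (J \<union> M)" by simp
      qed
    qed
    ultimately show ?thesis by (intro exI[of _ xs]) (simp add: xs_def)
  qed
  then have sub: "index_subgroups d p \<subseteq> (\<lambda>xs. subgrp hull (set xs \<union> M)) ` {xs. set xs \<subseteq> R \<and> length xs = ?q}"
    by blast
  have fin: "finite {xs. set xs \<subseteq> R \<and> length xs = ?q}" by (rule finite_lists_length_eq[OF R(1)])
  show "finite (index_subgroups d p)" using finite_subset[OF sub] fin by blast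
  have "card (index_subgroups d p) \<le> card {xs. set xs \<subseteq> R \<and> length xs = ?q}"
    by (rule surj_card_le[OF fin sub])
  also have "\<dots> = card R ^ ?q" by (rule card_lists_length_eq[OF R(1)])
  also have "\<dots> \<le> (d ^ p) ^ ?q" using R(2) by (rule power_mono) simp
  finally show "card (index_subgroups d p) \<le> (d ^ p) ^ ?q" .
qed

text \<open>In the exponent, \<open>p * (p * (p + 1))\<close> comes from the subgroups,
  \<open>p\<close> from \<open>mu\<close>, and 4 from \<open>b\<close> and \<open>N\<close>; the
  binomial counts weak compositions.\<close>

lemma card_codes:
  assumes d: "1 \<le> d" "d < 2 ^ (p + 1)"
  shows "finite (codes n d p)"
    "card (codes n d p) \<le> d ^ (p * (p * (p + 1)) + p + 4) * ((n + d - 1) choose (d - 1))"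
proof -
  let ?mu = "{mu. set mu \<subseteq> {1..int d} \<and> length mu = p}"
  let ?cs = "{cs::nat list. length cs = d \<and> sum_list cs = n}"
  have mu: "finite ?mu" "card ?mu = d ^ p"
    by (simp_all add: finite_lists_length_eq card_lists_length_eq)
  have "card ?cs = (n + d - 1) choose n" by (rule card_length_sum_list)
  also have "\<dots> = (n + d - 1) choose (d - 1)"
    using d binomial_symmetric[of n "n + d - 1"] by simp
  finally have cs: "card ?cs = (n + d - 1) choose (d - 1)" .
  \<comment> \<open>An infinite set has cardinality 0, so positivity yields finiteness.\<close>
  then have "card ?cs > 0" using d by simp
  then have cs_fin: "finite ?cs" by (rule card_ge_0_finite)
  show "finite (codes n d p)"
    unfolding codes_def using card_index_subgroups(1)[OF d] mu cs_fin by simp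
  have N: "card {0..<int (d ^ 3)} = d ^ 3"
    by (simp only: card_atLeastLessThan_int diff_zero nat_int)
  have "card (codes n d p) = card (index_subgroups d p) * (d ^ p * (d * (d ^ 3 * ((n + d - 1) choose (d - 1)))))"
    unfolding codes_def card_cartesian_product mu cs N by simp
  also have "\<dots> \<le> (d ^ p) ^ (p * (p + 1)) * (d ^ p * (d * (d ^ 3 * ((n + d - 1) choose (d - 1)))))"
    using card_index_subgroups(2)[OF d] by (rule mult_right_mono) simp
  also have "\<dots> = d ^ (p * (p * (p + 1)) + p + 4) * ((n + d - 1) choose (d - 1))"
  proof -
    have "d * d ^ 3 = d ^ 4" by (simp add: numeral_eq_Suc)
    then show ?thesis by (simp only: power_mult[symmetric] power_add mult.assoc[symmetric])
  qed
  finally show "card (codes n d p) \<le> d ^ (p * (p * (p + 1)) + p + 4) * ((n + d - 1) choose (d - 1))" .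
qed

lemma card_empty_modular_classes:
  assumes n: "1 \<le> n" and d: "1 \<le> d" and p: "2 ^ p \<le> d" "d < 2 ^ (p + 1)"
  shows "finite (empty_modular_classes n d)"
    "card (empty_modular_classes n d) \<le> d ^ (p * (p * (p + 1)) + p + 4) * ((n + d - 1) choose (d - 1))"
proof -
  define F where "F S = (SOME c. c \<in> codes n d p \<and> has_code n d S c)" for S
  have F: "F S \<in> codes n d p" "has_code n d S (F S)" if "S \<in> empty_modular_simplices n d" for S
  proof -
    have "\<exists>c. c \<in> codes n d p \<and> has_code n d S c" using has_code_exists[OF that n d p] by blast
    from someI_ex[OF this] show "F S \<in> codes n d p" "has_code n d S (F S)" by (simp_all add: F_def)
  qed
  have eq: "(S, S') \<in> integer_equivalence n"
    if "S \<in> empty_modular_simplices n d" "S' \<in> empty_modular_simplices n d" "F S = F S'" for S S'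
    using has_code_equivalent[OF F(1)[OF that(1)] F(2)[OF that(1)], of S'] F(2)[OF that(2)] that(3) d by simp
  note Q = card_quotient_le[of _ _ _ "empty_modular_simplices n d" F,
      OF equiv_integer_equivalence[of n] card_codes(1)[OF d p(2), of n] F(1) eq]
  show "finite (empty_modular_classes n d)" unfolding empty_modular_classes_def by (rule Q)
  show "card (empty_modular_classes n d) \<le> d ^ (p * (p * (p + 1)) + p + 4) * ((n + d - 1) choose (d - 1))"
    unfolding empty_modular_classes_def by (rule order_trans[OF Q(2) card_codes(2)[OF d p(2)]])
qed

section \<open>Analytic estimates and the final bound\<close>

text \<open>One term of the exponential series is at most its sum; this bounds the factorial below
  in place of Stirling's formula.\<close>

lemma power_le_exp_fact: "real k ^ k \<le> exp (real k) * fact k"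
proof -
  have "real k ^ k /\<^sub>R fact k \<le> (\<Sum>i. real k ^ i /\<^sub>R fact i)"
    using sum_le_suminf[of "\<lambda>i. real k ^ i /\<^sub>R fact i" "{k}"] summable_exp_generic[of "real k"] by simp
  also have "\<dots> = exp (real k)" by (simp add: exp_def)
  finally show ?thesis by (simp add: field_simps)
qed

text \<open>With \<open>k = d - 1\<close>, the binomial is at most
  \<open>(2 * n) ^ k / fact k\<close>, and \<open>fact k \<ge> (k / exp 1) ^ k\<close>. Replacing
  \<open>k\<close> by \<open>d \<le> 2 * k\<close> costs another factor 2 per power, whence
  \<open>4 * exp 1\<close>.\<close>

lemma binomial_bound:
  assumes d: "1 \<le> d" "d \<le> n"
  shows "real ((n + d - 1) choose (d - 1)) \<le> (4 * exp 1 * (real n / real d)) ^ (d - 1)"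
proof (cases "d = 1")
  case False
  define k where "k = d - 1"
  have k: "k > 0" "real d \<le> 2 * real k" "k \<le> n" "n + d - 1 = n + k" using d False by (auto simp: k_def)
  let ?b = "real ((n + k) choose k)"
  have "?b * fact k \<le> (real n + real k) ^ k"
    using binomial_fact_pow[of "n + k" k] by (metis of_nat_add of_nat_fact of_nat_le_iff of_nat_mult of_nat_power)
  also have "\<dots> \<le> (2 * real n) ^ k" using k by (intro power_mono) auto
  finally have b: "?b * fact k \<le> (2 * real n) ^ k" .
  have "?b * real k ^ k \<le> ?b * (exp (real k) * fact k)"
    by (rule mult_left_mono[OF power_le_exp_fact]) simp
  also have "\<dots> = exp 1 ^ k * (?b * fact k)" by (simp add: exp_of_nat_mult[symmetric])
  also have "\<dots> \<le> exp 1 ^ k * (2 * real n) ^ k" by (rule mult_left_mono[OF b]) simp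
  finally have "?b * real k ^ k \<le> (exp 1 * (2 * real n)) ^ k" by (simp add: power_mult_distrib)
  then have "?b \<le> (exp 1 * (2 * real n) / real k) ^ k"
    using k(1) by (simp add: power_divide pos_le_divide_eq)
  also have "\<dots> \<le> (4 * exp 1 * (real n / real d)) ^ k"
  proof (rule power_mono)
    have "real n * (2 * real k) \<ge> real n * real d" using k by (intro mult_left_mono) auto
    then show "exp 1 * (2 * real n) / real k \<le> 4 * exp 1 * (real n / real d)"
      using k d by (simp add: field_simps)
  qed simp
  finally show ?thesis using k by (simp add: k_def)
qed simp

text \<open>The binary logarithm of the left side is at most a polynomial in \<open>p\<close>,
  whereas \<open>d - 1\<close> grows like \<open>2 ^ p\<close>.\<close>

lemma quasipolynomial_le_exponential:
  obtains c :: nat where "\<And>d p. 1 \<le> d \<Longrightarrow> 2 ^ p \<le> d \<Longrightarrow> d < 2 ^ (p + 1) \<Longrightarrow>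
    d ^ (p * (p * (p + 1)) + p + 4) \<le> (2 ^ c) ^ (d - 1)"
proof -
  let ?E = "\<lambda>p::nat. p * (p * (p + 1)) + p + 4"
  let ?f = "\<lambda>p::nat. (real p + 1) * (real p * (real p * (real p + 1)) + real p + 4) / 2 ^ p"
  have "?f \<longlonglongrightarrow> 0" by real_asymp
  then have "Bseq ?f" by (rule convergent_imp_Bseq[OF convergentI])
  then obtain b where b: "\<forall>p. norm (?f p) \<le> b" unfolding Bseq_def by blast
  \<comment> \<open>The factor 2 pays for passing from \<open>2 ^ p\<close> to \<open>d - 1\<close>,
    as \<open>2 ^ p \<le> 2 * (d - 1)\<close> once \<open>p > 0\<close>.\<close>
  define c where "c = 2 * nat \<lceil>b\<rceil>"
  have f: "(p + 1) * ?E p \<le> nat \<lceil>b\<rceil> * 2 ^ p" for p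
  proof -
    have "?f p \<le> real (nat \<lceil>b\<rceil>)"
      by (rule order_trans[OF order_trans[OF abs_ge_self spec[OF b, of p, unfolded real_norm_def]] real_nat_ceiling_ge])
    then have "real ((p + 1) * ?E p) \<le> real (nat \<lceil>b\<rceil> * 2 ^ p)"
      by (simp add: pos_divide_le_eq algebra_simps)
    then show ?thesis by (simp only: of_nat_le_iff)
  qed
  have "d ^ ?E p \<le> (2 ^ c) ^ (d - 1)" if d: "1 \<le> d" "2 ^ p \<le> d" "d < 2 ^ (p + 1)" for d p
  proof (cases p)
    case 0
    then have "d = 1" using d by simp
    then show ?thesis by simp
  next
    case (Suc q)
    have "2 ^ p \<le> 2 * (d - 1)"
    proof -
      have "(1::nat) \<le> 2 ^ q" by simp
      then show ?thesis using d(2) Suc by simp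
    qed
    then have "(p + 1) * ?E p \<le> nat \<lceil>b\<rceil> * (2 * (d - 1))" using f[of p] by (meson mult_le_mono2 order_trans)
    then have E: "(p + 1) * ?E p \<le> c * (d - 1)" by (simp add: c_def)
    have "d ^ ?E p \<le> (2 ^ (p + 1)) ^ ?E p" using d by (intro power_mono) auto
    also have "\<dots> = 2 ^ ((p + 1) * ?E p)" by (rule power_mult[symmetric])
    also have "\<dots> \<le> 2 ^ (c * (d - 1))" using E by (rule power_increasing) simp
    also have "\<dots> = (2 ^ c) ^ (d - 1)" by (rule power_mult)
    finally show ?thesis .
  qed
  then show ?thesis using that by blast
qed

text \<open>The constant merges the exponential bound on the powers of \<open>d\<close> with the
  bound on the binomial.\<close>

lemma empty_modular_classes_bound:
  obtains C :: real where "C > 0" "\<And>n d. 1 \<le> d \<Longrightarrow> d \<le> n \<Longrightarrow> finite (empty_modular_classes n d) \<and>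
    real (card (empty_modular_classes n d)) \<le> (C * (real n / real d)) ^ (d - 1)"
proof -
  obtain c :: nat where c: "\<And>d p. 1 \<le> d \<Longrightarrow> 2 ^ p \<le> d \<Longrightarrow> d < 2 ^ (p + 1) \<Longrightarrow>
      d ^ (p * (p * (p + 1)) + p + 4) \<le> (2 ^ c) ^ (d - 1)"
    using quasipolynomial_le_exponential by blast
  define C :: real where "C = 2 ^ c * (4 * exp 1)"
  have "finite (empty_modular_classes n d) \<and>
      real (card (empty_modular_classes n d)) \<le> (C * (real n / real d)) ^ (d - 1)"
    if d: "1 \<le> d" "d \<le> n" for n d
  proof -
    have n: "1 \<le> n" using d by simp
    obtain p where p: "2 ^ p \<le> d" "d < 2 ^ (p + 1)" using ex_power_ivl1[of 2 d] d by auto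
    let ?b = "(n + d - 1) choose (d - 1)"
    have "card (empty_modular_classes n d) \<le> (2 ^ c) ^ (d - 1) * ?b"
      using card_empty_modular_classes(2)[OF n d(1) p] mult_right_mono[OF c[OF d(1) p], of ?b] by linarith
    then have "real (card (empty_modular_classes n d)) \<le> real ((2 ^ c) ^ (d - 1) * ?b)"
      by (simp only: of_nat_le_iff)
    also have "\<dots> = (2 ^ c) ^ (d - 1) * real ?b" by simp
    also have "\<dots> \<le> (2 ^ c) ^ (d - 1) * (4 * exp 1 * (real n / real d)) ^ (d - 1)"
      by (rule mult_left_mono[OF binomial_bound[OF d]]) simp
    also have "\<dots> = (C * (real n / real d)) ^ (d - 1)"
      unfolding power_mult_distrib[symmetric] C_def by (simp only: mult.assoc)
    finally show ?thesis using card_empty_modular_classes(1)[OF n d(1) p] by blast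
  qed
  moreover have "C > 0" by (simp add: C_def)
  ultimately show ?thesis using that by blast
qed

theorem theorem16:
  shows
    "(\<exists>C::real. C > 0 \<and> (\<forall>(n::nat) (\<Delta>::nat). 1 \<le> \<Delta> \<and> \<Delta> \<le> n \<longrightarrow>
        finite (empty_modular_classes n \<Delta>) \<and>
        real (card (empty_modular_classes n \<Delta>))
          \<le> (C * (real n / real \<Delta>)) ^ (\<Delta> - 1) * real \<Delta> powr (log 2 (real \<Delta>) + 2)))
     \<and>
     (\<forall>\<Delta>::nat. 1 \<le> \<Delta> \<longrightarrow>
        (\<exists>p::real poly. degree p = \<Delta> - 1 \<and>
          (\<forall>n::nat. \<Delta> \<le> n \<longrightarrow> real (card (empty_modular_classes n \<Delta>)) \<le> poly p (real n))))"
proof -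
  obtain C :: real where C: "C > 0" "\<And>n d. 1 \<le> d \<Longrightarrow> d \<le> n \<Longrightarrow> finite (empty_modular_classes n d) \<and>
      real (card (empty_modular_classes n d)) \<le> (C * (real n / real d)) ^ (d - 1)"
    using empty_modular_classes_bound by blast
  have "finite (empty_modular_classes n d) \<and> real (card (empty_modular_classes n d))
      \<le> (C * (real n / real d)) ^ (d - 1) * real d powr (log 2 (real d) + 2)" if "1 \<le> d \<and> d \<le> n" for n d
  proof -
    \<comment> \<open>For \<open>d \<ge> 1\<close> both the base is at least 1 and the exponent is
      positive.\<close>
    have "1 \<le> real d powr (log 2 (real d) + 2)" using that by (intro ge_one_powr_ge_zero) auto
    moreover have "0 \<le> (C * (real n / real d)) ^ (d - 1)" using C(1) by simp
    ultimately have "(C * (real n / real d)) ^ (d - 1) * 1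
        \<le> (C * (real n / real d)) ^ (d - 1) * real d powr (log 2 (real d) + 2)"
      by (rule mult_left_mono)
    then show ?thesis using C(2)[of d n] that by linarith
  qed
  moreover have "\<exists>p::real poly. degree p = d - 1 \<and>
      (\<forall>n. d \<le> n \<longrightarrow> real (card (empty_modular_classes n d)) \<le> poly p (real n))" if d: "1 \<le> d" for d
  proof (intro exI conjI allI impI)
    \<comment> \<open>The coefficient is nonzero since \<open>C > 0\<close>, so the monomial has
      degree exactly \<open>d - 1\<close>.\<close>
    show "degree (monom ((C / real d) ^ (d - 1)) (d - 1)) = d - 1"
      using C(1) d by (intro degree_monom_eq) simp
    show "real (card (empty_modular_classes n d)) \<le> poly (monom ((C / real d) ^ (d - 1)) (d - 1)) (real n)"
      if "d \<le> n" for n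
    proof -
      have "(C * (real n / real d)) ^ (d - 1) = (C / real d) ^ (d - 1) * real n ^ (d - 1)"
        unfolding power_mult_distrib[symmetric] by simp
      then show ?thesis using C(2)[OF d that] by (simp only: poly_monom)
    qed
  qed
  ultimately show ?thesis using C(1) by blast
qed

end
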